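(* Let $\sigma$ be an arbitrary quantum state (randomness source) on a finite-dimensional system $B$ with eigenspace decomposition $\sigma=\sum_i\lambda_i\Pi_i$, and let $r_i=\mathrm{Tr}\,\Pi_i$. Then the maximal entropy production from $\sigma$ is $S(\sigma)+\Delta(\sigma)$, where $\Delta(\sigma)=\sum_i\lambda_ir_i\log_2r_i$.
   Context: All systems are finite-dimensional. $S(\rho)=-\mathrm{Tr}[\rho\log_2\rho]$. In the eigenspace decomposition, the $\lambda_i$ are the distinct eigenvalues of $\sigma$ and $\Pi_i$ are the orthogonal projectors onto the corresponding eigenspaces. A quantum map $\Phi$ on a system $A$ is a catalytic map using the catalyst $\sigma_B$ if there are a unitary $U$ on $AB$ and a unitary $V$ on $B$ with $\mathrm{Tr}_B\,U(\rho_A\otimes\sigma_B)U^\dagger=\Phi(\rho)$ and $\mathrm{Tr}_A\,U(\rho_A\otimes\sigma_B)U^\dagger=V\sigma_BV^\dagger$ for all states $\rho$ on $A$. The maximal entropy production from $\sigma$ is the maximum of $S((\mathcal{I}_R\otimes\Phi)(\rho))-S(\rho)$ over all finite-dimensional systems $A$ and reference systems $R$, all catalytic maps $\Phi$ on $A$ using the catalyst $\sigma$, and all states $\rho$ on $RA$. *)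

theory Defs
  imports
    Complex_Main
    "Jordan_Normal_Form.Schur_Decomposition"
    "Jordan_Normal_Form.Spectral_Radius"
begin

(* A d-dimensional system is the space of vectors in carrier_vec d over the complex numbers;
   operators on it are the matrices in carrier_mat d d. *)

definition mat_trace :: "complex mat \<Rightarrow> complex" where
  "mat_trace A = (\<Sum>i<dim_row A. A $$ (i, i))"

definition hermitian_mat :: "nat \<Rightarrow> complex mat \<Rightarrow> bool" where
  "hermitian_mat d A \<longleftrightarrow> A \<in> carrier_mat d d \<and> mat_adjoint A = A"

definition unitary_mat :: "nat \<Rightarrow> complex mat \<Rightarrow> bool" where
  "unitary_mat d U \<longleftrightarrow>
     U \<in> carrier_mat d d \<and> mat_adjoint U * U = 1\<^sub>m d \<and> U * mat_adjoint U = 1\<^sub>m d"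

(* The order on complex numbers is the one of HOL-Library.Complex_Order: 0 \<le> z states that
   z is real and nonnegative. *)
definition psd_mat :: "nat \<Rightarrow> complex mat \<Rightarrow> bool" where
  "psd_mat d A \<longleftrightarrow>
     hermitian_mat d A \<and> (\<forall>v \<in> carrier_vec d. 0 \<le> (A *\<^sub>v v) \<bullet>c v)"

definition quantum_state :: "nat \<Rightarrow> complex mat \<Rightarrow> bool" where
  "quantum_state d \<rho> \<longleftrightarrow> psd_mat d \<rho> \<and> mat_trace \<rho> = 1"

definition eigenspace :: "complex mat \<Rightarrow> complex \<Rightarrow> complex vec set" where
  "eigenspace A k = {v \<in> carrier_vec (dim_row A). A *\<^sub>v v = k \<cdot>\<^sub>v v}"

definition orth_projector :: "nat \<Rightarrow> complex vec set \<Rightarrow> complex mat" where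
  "orth_projector d E =
     (THE P. hermitian_mat d P \<and> P * P = P \<and> (\<lambda>v. P *\<^sub>v v) ` carrier_vec d = E)"

definition eigen_projector :: "complex mat \<Rightarrow> complex \<Rightarrow> complex mat" where
  "eigen_projector A k = orth_projector (dim_row A) (eigenspace A k)"

(* Functional calculus for a Hermitian A, whose distinct eigenvalues are the members of the
   (finite) set spectrum A: the entrywise form of the sum of f(k) times the projector of k. *)
definition mat_fun :: "(real \<Rightarrow> real) \<Rightarrow> complex mat \<Rightarrow> complex mat" where
  "mat_fun f A = mat (dim_row A) (dim_row A)
     (\<lambda>(i, j). \<Sum>k \<in> spectrum A. complex_of_real (f (Re k)) * eigen_projector A k $$ (i, j))"

(* log 2 0 = 0 in HOL; the value is irrelevant here, since the kernel of \<rho> contributes 0 to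
   the product \<rho> * log \<rho>. This is the usual convention 0 log 0 = 0. *)
definition entropy :: "complex mat \<Rightarrow> real" where
  "entropy \<rho> = - Re (mat_trace (\<rho> * mat_fun (log 2) \<rho>))"

definition eigen_mult :: "complex mat \<Rightarrow> complex \<Rightarrow> real" where
  "eigen_mult \<sigma> k = Re (mat_trace (eigen_projector \<sigma> k))"

(* With eigenspace decomposition \<sigma> = \<Sum>i. \<lambda>\<^sub>i \<Pi>\<^sub>i and r\<^sub>i = Tr \<Pi>\<^sub>i (eigen_mult) this is
   \<Sum>i. \<lambda>\<^sub>i r\<^sub>i log\<^sub>2 r\<^sub>i; the index i is the eigenvalue itself. *)
definition Delta :: "complex mat \<Rightarrow> real" where
  "Delta \<sigma> = (\<Sum>k \<in> spectrum \<sigma>. Re k * eigen_mult \<sigma> k * log 2 (eigen_mult \<sigma> k))"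

(* Composite systems: in a system of dimension d1 * d2, the basis vector e_a \<otimes> e_b
   has index a * d2 + b. *)

definition tensor_mat :: "complex mat \<Rightarrow> complex mat \<Rightarrow> complex mat" where
  "tensor_mat A B = mat (dim_row A * dim_row B) (dim_col A * dim_col B)
     (\<lambda>(i, j). A $$ (i div dim_row B, j div dim_col B) * B $$ (i mod dim_row B, j mod dim_col B))"

definition ptrace_fst :: "nat \<Rightarrow> nat \<Rightarrow> complex mat \<Rightarrow> complex mat" where
  "ptrace_fst d1 d2 X = mat d2 d2 (\<lambda>(b, b'). \<Sum>a<d1. X $$ (a * d2 + b, a * d2 + b'))"

definition ptrace_snd :: "nat \<Rightarrow> nat \<Rightarrow> complex mat \<Rightarrow> complex mat" where
  "ptrace_snd d1 d2 X = mat d1 d1 (\<lambda>(a, a'). \<Sum>b<d2. X $$ (a * d2 + b, a' * d2 + b))"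

(* The map \<I> \<otimes> \<Phi> for a linear \<Phi>: \<Phi> acts on each of the d1 * d1 blocks of X,
   which are operators on the second factor. *)
definition id_tensor :: "nat \<Rightarrow> nat \<Rightarrow> (complex mat \<Rightarrow> complex mat) \<Rightarrow> complex mat \<Rightarrow> complex mat" where
  "id_tensor d1 d2 \<Phi> X = mat (d1 * d2) (d1 * d2)
     (\<lambda>(i, j). \<Phi> (mat d2 d2 (\<lambda>(a, a'). X $$ ((i div d2) * d2 + a, (j div d2) * d2 + a')))
                 $$ (i mod d2, j mod d2))"

(* Completely positive trace-preserving linear maps on a d-dimensional system; only the
   restriction of \<Phi> to carrier_mat d d matters. *)
definition quantum_map :: "nat \<Rightarrow> (complex mat \<Rightarrow> complex mat) \<Rightarrow> bool" where
  "quantum_map d \<Phi> \<longleftrightarrow>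
     (\<forall>X \<in> carrier_mat d d. \<Phi> X \<in> carrier_mat d d) \<and>
     (\<forall>X \<in> carrier_mat d d. \<forall>Y \<in> carrier_mat d d. \<Phi> (X + Y) = \<Phi> X + \<Phi> Y) \<and>
     (\<forall>c. \<forall>X \<in> carrier_mat d d. \<Phi> (c \<cdot>\<^sub>m X) = c \<cdot>\<^sub>m \<Phi> X) \<and>
     (\<forall>X \<in> carrier_mat d d. mat_trace (\<Phi> X) = mat_trace X) \<and>
     (\<forall>dR X. psd_mat (dR * d) X \<longrightarrow> psd_mat (dR * d) (id_tensor dR d \<Phi> X))"

definition catalytic_map :: "nat \<Rightarrow> nat \<Rightarrow> complex mat \<Rightarrow> (complex mat \<Rightarrow> complex mat) \<Rightarrow> bool" where
  "catalytic_map dA dB \<sigma> \<Phi> \<longleftrightarrow>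
     quantum_map dA \<Phi> \<and>
     (\<exists>U V. unitary_mat (dA * dB) U \<and> unitary_mat dB V \<and>
        (\<forall>\<rho>. quantum_state dA \<rho> \<longrightarrow>
           ptrace_snd dA dB (U * tensor_mat \<rho> \<sigma> * mat_adjoint U) = \<Phi> \<rho> \<and>
           ptrace_fst dA dB (U * tensor_mat \<rho> \<sigma> * mat_adjoint U) = V * \<sigma> * mat_adjoint V))"

definition entropy_productions :: "nat \<Rightarrow> complex mat \<Rightarrow> real set" where
  "entropy_productions dB \<sigma> =
     {entropy (id_tensor dR dA \<Phi> \<rho>) - entropy \<rho> | dR dA \<Phi> \<rho>.
        catalytic_map dA dB \<sigma> \<Phi> \<and> quantum_state (dR * dA) \<rho>}"

definition is_maximal_entropy_production :: "nat \<Rightarrow> complex mat \<Rightarrow> real \<Rightarrow> bool" where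
  "is_maximal_entropy_production dB \<sigma> m \<longleftrightarrow>
     m \<in> entropy_productions dB \<sigma> \<and> (\<forall>x \<in> entropy_productions dB \<sigma>. x \<le> m)"

end

theory Submission
  imports Defs "HOL-Number_Theory.Cong"
begin

text \<open>
  Upper bound. In an eigenbasis of the catalyst, with eigenvalues \<open>l\<^sub>e\<close>, a catalytic map has the Kraus
  operators \<open>\<surd>l\<^sub>e \<langle>b|U|e\<rangle>\<close>, and the catalyst condition forces \<open>\<langle>b|U|e\<rangle> = 0\<close> unless \<open>l\<^sub>b = l\<^sub>e\<close>.
  Applying the Kraus operators to the eigenvectors (with eigenvalues \<open>p\<^sub>k\<close>) of the input
  writes the output as a sum of rank-one operators \<open>x x\<^sup>*\<close> indexed by \<open>(b, e, k)\<close>, whose weights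
  \<open>\<parallel>x\<parallel>\<^sup>2\<close> sum over \<open>b\<close> to \<open>l\<^sub>e p\<^sub>k\<close>. The entropy of such a sum is at most the cross entropy of the
  weights relative to any probability distribution; choosing
  \<open>(l\<^sub>e / r\<^sub>e) p\<^sub>k\<close> on the pairs with \<open>l\<^sub>b = l\<^sub>e\<close>, where \<open>r\<^sub>e\<close> is the multiplicity of \<open>l\<^sub>e\<close>, gives exactly
  \<open>S(\<rho>) + S(\<sigma>) + \<Delta>(\<sigma>)\<close>.

  Attainment. Take for \<open>\<langle>b|U|e\<rangle>\<close> a Fourier coefficient on the eigenspace times a cyclic shift of a
  register, with distinct shifts for distinct pairs \<open>(b, e)\<close>: both \<open>U\<close> and its transpose in the
  \<open>b, e\<close> indices are then unitary, and a pure register state is sent to a diagonal state with the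
  eigenvalues \<open>l\<^sub>e / r\<^sub>e\<close>.
\<close>

section \<open>Matrix indices and the spectral theorem\<close>

text \<open>Write U_be for the block <b|U|e>, an operator on A. Column unitarity of U says that the
  sum over b of adj(U_be') U_be is 1 for e = e' and 0 otherwise. Restoring a diagonal catalyst for
  every input says that the sum over e of l_e adj(U_b'e) U_be is l_b for b = b' and 0 otherwise;
  once the blocks between different eigenvalues vanish, this follows from the first condition with b
  and e exchanged. Attainment has to meet both conditions and still make the images orthogonal.
  Shifts by b d + e do so because the exponent is a sum: for equal b the part b d cancels, for equal
  e the part e cancels, and a scalar orthogonality relation for f remains. The register size d^2
  counts the pairs (b, e). Fourier entries all have modulus 1/sqrt r, which makes the weights equal
  to the distribution chosen in the upper bound. Two gaps remain. A catalytic map is tied to U only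
  on states, whereas I tensor Phi evaluates it on blocks that need not be Hermitian; linearity
  closes this gap. The catalyst may return rotated by V; this rotation is absorbed into U.\<close>

lemma sum_lessThan_mult:
  "(\<Sum>i<m * n. f i) = (\<Sum>a<m. \<Sum>b<n. f (a * n + b :: nat))"
proof -
  have "(\<Sum>i<m * n. f i) = (\<Sum>a<m. sum f {a * n..<a * n + n})"
    by (rule sum.nat_group[symmetric])
  also have "\<dots> = (\<Sum>a<m. \<Sum>b<n. f (a * n + b))"
  proof (rule sum.cong[OF refl])
    fix a
    show "sum f {a * n..<a * n + n} = (\<Sum>b<n. f (a * n + b))"
      using sum.shift_bounds_nat_ivl[of f 0 "a * n" n] by (simp add: lessThan_atLeast0 add.commute)
  qed
  finally show ?thesis .
qed

lemma pair_index_less: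
  fixes a b m n :: nat
  assumes "a < m" "b < n"
  shows "a * n + b < m * n"
proof -
  have "a * n + b < (a + 1) * n" using assms by simp
  also have "\<dots> \<le> m * n" using assms by (intro mult_right_mono) auto
  finally show ?thesis .
qed

section \<open>Adjoints, products and unitarity in coordinates\<close>

lemma adjoint_carrier [simp]: "A \<in> carrier_mat m n \<Longrightarrow> mat_adjoint A \<in> carrier_mat n m"
  by (auto simp: mat_adjoint_def mat_of_rows_def)

lemma adjoint_dim [simp]: "dim_row (mat_adjoint A) = dim_col A" "dim_col (mat_adjoint A) = dim_row A"
  by (auto simp: mat_adjoint_def mat_of_rows_def)

lemma adjoint_index [simp]:
  "i < dim_col A \<Longrightarrow> j < dim_row A \<Longrightarrow> mat_adjoint A $$ (i, j) = cnj (A $$ (j, i))"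
  by (simp add: mat_adjoint_def mat_of_rows_def)

lemma mult_index:
  assumes "A \<in> carrier_mat m n" "B \<in> carrier_mat n p" "i < m" "j < p"
  shows "(A * B) $$ (i, j) = (\<Sum>k<n. A $$ (i, k) * B $$ (k, j))"
  using assms by (auto simp: scalar_prod_def lessThan_atLeast0 intro!: sum.cong)

lemma mult_vec_index:
  assumes "A \<in> carrier_mat m n" "v \<in> carrier_vec n" "i < m"
  shows "(A *\<^sub>v v) $ i = (\<Sum>k<n. A $$ (i, k) * v $ k)"
  using assms by (auto simp: scalar_prod_def lessThan_atLeast0 intro!: sum.cong)

lemma cscalar_prod_eq_sum:
  fixes v w :: "complex vec"
  assumes "v \<in> carrier_vec n" "w \<in> carrier_vec n"
  shows "v \<bullet>c w = (\<Sum>k<n. v $ k * cnj (w $ k))"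
  using assms by (auto simp: scalar_prod_def lessThan_atLeast0 intro!: sum.cong)

lemma adjoint_adjoint [simp]: "mat_adjoint (mat_adjoint A) = (A :: complex mat)"
  by (rule eq_matI) auto

lemma adjoint_mult:
  fixes A B :: "complex mat"
  assumes "A \<in> carrier_mat m n" "B \<in> carrier_mat n p"
  shows "mat_adjoint (A * B) = mat_adjoint B * mat_adjoint A"
proof (rule eq_matI)
  fix i j assume "i < dim_row (mat_adjoint B * mat_adjoint A)" "j < dim_col (mat_adjoint B *
    mat_adjoint A)"
  then have "i < p" "j < m" using assms by auto
  then show "mat_adjoint (A * B) $$ (i, j) = (mat_adjoint B * mat_adjoint A) $$ (i, j)"
    using assms
    by (subst mult_index[of _ p n _ m]) (auto simp: mult_index[OF assms] mult.commute simp del: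
      index_mult_mat(1))
qed (use assms in auto)

text \<open>For square matrices a left inverse is also a right inverse, so unitarity can be
  established by checking columns only.\<close>

lemma unitary_matI:
  assumes "U \<in> carrier_mat d d" "mat_adjoint U * U = 1\<^sub>m d"
  shows "unitary_mat d U"
  using assms mat_mult_left_right_inverse[of "mat_adjoint U" d U] by (simp add: unitary_mat_def)

lemma unitary_mat_adjoint: "unitary_mat d U \<Longrightarrow> unitary_mat d (mat_adjoint U)"
  by (simp add: unitary_mat_def)

lemma unitary_mat_mult:
  assumes "unitary_mat d U" "unitary_mat d V"
  shows "unitary_mat d (U * V)"
proof (rule unitary_matI)
  have U: "U \<in> carrier_mat d d" "mat_adjoint U \<in> carrier_mat d d"
    and V: "V \<in> carrier_mat d d" "mat_adjoint V \<in> carrier_mat d d"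
    using assms by (auto simp: unitary_mat_def)
  show "U * V \<in> carrier_mat d d" using U V by auto
  have "mat_adjoint (U * V) * (U * V) = mat_adjoint V * ((mat_adjoint U * U) * V)"
    using U V adjoint_mult[OF U(1) V(1)] by (simp add: assoc_mult_mat[of _ d d _ d _ d])
  then show "mat_adjoint (U * V) * (U * V) = 1\<^sub>m d"
    using assms V by (simp add: unitary_mat_def)
qed

lemma unitary_mat_sum_col:
  assumes "unitary_mat d U" "i < d" "j < d"
  shows "(\<Sum>k<d. cnj (U $$ (k, i)) * U $$ (k, j)) = (if i = j then 1 else 0)"
proof -
  have U: "U \<in> carrier_mat d d" "mat_adjoint U * U = 1\<^sub>m d" using assms
    by (auto simp: unitary_mat_def)
  have "(\<Sum>k<d. cnj (U $$ (k, i)) * U $$ (k, j)) = (mat_adjoint U * U) $$ (i, j)"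
    using U(1) assms by (subst mult_index[of _ d d _ d]) auto
  then show ?thesis using U assms by simp
qed

lemma unitary_mat_sum_row:
  assumes "unitary_mat d U" "i < d" "j < d"
  shows "(\<Sum>k<d. U $$ (i, k) * cnj (U $$ (j, k))) = (if i = j then 1 else 0)"
proof -
  have U: "U \<in> carrier_mat d d" "U * mat_adjoint U = 1\<^sub>m d" using assms
    by (auto simp: unitary_mat_def)
  have "(\<Sum>k<d. U $$ (i, k) * cnj (U $$ (j, k))) = (U * mat_adjoint U) $$ (i, j)"
    using U(1) assms by (subst mult_index[of _ d d _ d]) auto
  then show ?thesis using U assms by simp
qed

section \<open>The spectral theorem for Hermitian matrices\<close>

definition spectral_decomp :: "nat \<Rightarrow> complex mat \<Rightarrow> complex mat \<Rightarrow> (nat \<Rightarrow> real) \<Rightarrow> bool" where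
  "spectral_decomp d A W p \<longleftrightarrow> A \<in> carrier_mat d d \<and> unitary_mat d W \<and>
     (\<forall>i<d. \<forall>j<d. A $$ (i, j) = (\<Sum>k<d. complex_of_real (p k) * W $$ (i, k) * cnj (W $$ (j, k))))"

lemma mat_conj_conj:
  fixes D :: "'a :: comm_semiring_1 mat"
  assumes "P \<in> carrier_mat d d" "Q \<in> carrier_mat d d" "D \<in> carrier_mat d d"
    "Q' \<in> carrier_mat d d" "P' \<in> carrier_mat d d"
  shows "P * (Q * D * Q') * P' = (P * Q) * D * (Q' * P')"
proof -
  have "P * (Q * D * Q') = (P * Q * D) * Q'"
    using assms assoc_mult_mat[of P d d "Q * D" d Q' d] assoc_mult_mat[of P d d Q d D d]
    by (metis mult_carrier_mat)
  moreover have "(P * Q * D) * Q' * P' = (P * Q * D) * (Q' * P')"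
    using assms by (intro assoc_mult_mat[of _ d d _ d _ d] mult_carrier_mat[of _ d d _ d]) auto
  ultimately show ?thesis by simp
qed

lemma hermitian_conjugate_unitary:
  fixes A W :: "complex mat"
  assumes "hermitian_mat d A" "W \<in> carrier_mat d d"
  shows "hermitian_mat d (mat_adjoint W * A * W)"
proof -
  have A: "A \<in> carrier_mat d d" "mat_adjoint A = A" using assms by (auto simp: hermitian_mat_def)
  have W: "W \<in> carrier_mat d d" "mat_adjoint W \<in> carrier_mat d d" using assms by auto
  have "mat_adjoint (mat_adjoint W * A * W) = mat_adjoint W * (mat_adjoint A * W)"
    unfolding adjoint_mult[OF mult_carrier_mat[OF W(2) A(1)] W(1)] adjoint_mult[OF W(2) A(1)]
      adjoint_adjoint ..
  also have "\<dots> = mat_adjoint W * A * W" unfolding A(2)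
    by (rule assoc_mult_mat[OF W(2) A(1) W(1), symmetric])
  finally show ?thesis
    using mult_carrier_mat[OF mult_carrier_mat[OF W(2) A(1)] W(1)]
      unfolding hermitian_mat_def by blast
qed

text \<open>Gram-Schmidt on a basis that starts with \<open>v\<close> keeps \<open>v\<close> in
  first place. It gives orthogonal but not normalised vectors, hence the scaling by
  \<open>c j\<close>, and hence a first column that is only a multiple of \<open>v\<close>.\<close>

lemma exists_unitary_first_col:
  assumes v: "v \<in> carrier_vec n" "v \<noteq> 0\<^sub>v n"
  obtains W :: "complex mat" and c :: complex where "unitary_mat n W" "col W 0 = c \<cdot>\<^sub>v v"
proof -
  interpret cof_vec_space n "TYPE(complex)" .
  define b where "b = basis_completion v"
  define ws where "ws = gram_schmidt n b"
  from basis_completion[OF v, folded b_def]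
  have span_b: "span (set b) = carrier_vec n" and dist_b: "distinct b"
    and indep: "\<not> lin_dep (set b)" and b: "set b \<subseteq> carrier_vec n" and hdb: "hd b = v"
    and len_b: "length b = n" by auto
  have n: "n \<noteq> 0" using v by auto
  from hdb len_b n obtain vs where bv: "b = v # vs" by (cases b) auto
  from gram_schmidt_result[OF b dist_b indep refl, folded ws_def]
  have ws: "set ws \<subseteq> carrier_vec n" "corthogonal ws" "length ws = n"
    by (auto simp: len_b)
  from gram_schmidt_hd[OF v(1), of vs, folded bv] have hdws: "hd ws = v" unfolding ws_def .
  have ws0: "ws ! 0 = v" using hdws ws(3) n by (metis hd_conv_nth length_0_conv)
  define s where "s j = (\<Sum>k<n. (cmod (ws ! j $ k))\<^sup>2)" for j
  have carr: "ws ! j \<in> carrier_vec n" if "j < n" for j using ws that by auto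
  have orth: "(\<Sum>k<n. ws ! i $ k * cnj (ws ! j $ k)) = 0 \<longleftrightarrow> i \<noteq> j" if "i < n" "j < n" for i j
    using corthogonalD[OF ws(2)] that carr by (simp add: ws(3) cscalar_prod_eq_sum[where n = n])
  have s_eq: "(\<Sum>k<n. ws ! j $ k * cnj (ws ! j $ k)) = complex_of_real (s j)" for j
    by (simp add: s_def complex_mult_cnj cmod_power2)
  have s_pos: "s j > 0" if "j < n" for j
  proof -
    have "s j \<noteq> 0" using orth[OF that that] s_eq[of j] by auto
    moreover have "s j \<ge> 0" by (auto simp: s_def intro: sum_nonneg)
    ultimately show ?thesis by simp
  qed
  define c where "c j = complex_of_real (1 / sqrt (s j))" for j
  define W where "W = mat n n (\<lambda>(i, j). c j * ws ! j $ i)"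
  have W: "W \<in> carrier_mat n n" by (simp add: W_def)
  have "mat_adjoint W * W = 1\<^sub>m n"
  proof (rule eq_matI)
    fix i j assume "i < dim_row (1\<^sub>m n :: complex mat)" "j < dim_col (1\<^sub>m n :: complex mat)"
    then have ij: "i < n" "j < n" by auto
    have "(mat_adjoint W * W) $$ (i, j) = (\<Sum>k<n. cnj (W $$ (k, i)) * W $$ (k, j))"
      using W ij by (subst mult_index[of _ n n _ n]) auto
    also have "\<dots> = c i * c j * (\<Sum>k<n. ws ! j $ k * cnj (ws ! i $ k))"
      using ij by (simp add: W_def c_def sum_distrib_left mult_ac)
    also have "\<dots> = 1\<^sub>m n $$ (i, j)"
    proof (cases "i = j")
      case True
      have "c j * c j * complex_of_real (s j) =
        complex_of_real (1 / sqrt (s j) * (1 / sqrt (s j)) * s j)"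
        by (simp only: c_def of_real_mult)
      also have "1 / sqrt (s j) * (1 / sqrt (s j)) * s j = 1" using s_pos[OF ij(2)] by simp
      finally show ?thesis using True ij by (simp add: s_eq)
    next
      case False
      then show ?thesis using orth[OF ij(2,1)] ij by simp
    qed
    finally show "(mat_adjoint W * W) $$ (i, j) = 1\<^sub>m n $$ (i, j)" .
  qed (use W in auto)
  then have "unitary_mat n W" using W by (intro unitary_matI)
  moreover have "col W 0 = c 0 \<cdot>\<^sub>v v"
    using n v by (intro eq_vecI) (auto simp: W_def ws0)
  ultimately show ?thesis using that by blast
qed

lemma hermitian_index: "hermitian_mat d A \<Longrightarrow> i < d \<Longrightarrow> j < d \<Longrightarrow> A $$ (i, j) = cnj (A $$ (j, i))"
  unfolding hermitian_mat_def by (metis adjoint_index carrier_matD)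

lemma mat_conj_index:
  assumes "W \<in> carrier_mat d d" "A \<in> carrier_mat d d" "i < d" "j < d"
  shows "(W * A * mat_adjoint W) $$ (i, j) =
    (\<Sum>k<d. \<Sum>l<d. W $$ (i, k) * A $$ (k, l) * cnj (W $$ (j, l)))"
proof -
  have "(W * A * mat_adjoint W) $$ (i, j) =
    (\<Sum>l<d. (\<Sum>k<d. W $$ (i, k) * A $$ (k, l)) * cnj (W $$ (j, l)))"
    using assms by (subst mult_index[of _ d d _ d]) (auto simp: mult_index[of W d d A d] simp del:
      index_mult_mat(1))
  also have "\<dots> = (\<Sum>l<d. \<Sum>k<d. W $$ (i, k) * A $$ (k, l) * cnj (W $$ (j, l)))"
    by (simp add: sum_distrib_right)
  finally show ?thesis by (subst sum.swap) 
qed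

text \<open>The entrywise form is the one substituted into sums; the matrix form is the one that
  composes under conjugation, as needed in the induction below and when the catalyst is
  rotated.\<close>

lemma spectral_decomp_iff:
  "spectral_decomp d A W p \<longleftrightarrow> A \<in> carrier_mat d d \<and> unitary_mat d W \<and>
     A = W * mat d d (\<lambda>(i, j). if i = j then complex_of_real (p i) else 0) * mat_adjoint W"
    (is "_ \<longleftrightarrow> _ \<and> _ \<and> A = W * ?D * _")
proof -
  have "(\<forall>i<d. \<forall>j<d. A $$ (i, j) = (\<Sum>k<d. complex_of_real (p k) * W $$ (i, k) * cnj (W $$ (j, k)))) \<longleftrightarrow>
     A = W * ?D * mat_adjoint W" if "A \<in> carrier_mat d d" "W \<in> carrier_mat d d"
  proof -
    have "(W * ?D * mat_adjoint W) $$ (i, j) =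
      (\<Sum>k<d. complex_of_real (p k) * W $$ (i, k) * cnj (W $$ (j, k)))"
      if "i < d" "j < d" for i j
    proof -
      have "(W * ?D * mat_adjoint W) $$ (i, j) =
        (\<Sum>k<d. \<Sum>l<d. W $$ (i, k) * ?D $$ (k, l) * cnj (W $$ (j, l)))"
        using that \<open>W \<in> carrier_mat d d\<close> by (intro mat_conj_index) auto
      also have "\<dots> = (\<Sum>k<d. \<Sum>l<d. if k =
        l then complex_of_real (p k) * W $$ (i, k) * cnj (W $$ (j, k)) else 0)"
        by (intro sum.cong) auto
      finally show ?thesis by simp
    qed
    then show ?thesis using that by (auto intro!: eq_matI simp del: index_mult_mat(1))
  qed
  then show ?thesis by (auto simp: spectral_decomp_def unitary_mat_def)
qed

text \<open>Deflation: in an orthonormal basis whose first vector is an eigenvector, the first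
  column of the matrix is a multiple of a unit vector, hermiticity clears the first row as well, and
  the induction hypothesis diagonalises the remaining block.\<close>

theorem hermitian_spectral_decomp:
  assumes "hermitian_mat n A"
  shows "\<exists>W p. spectral_decomp n A W p"
  using assms
proof (induction n arbitrary: A)
  case 0
  then have "A \<in> carrier_mat 0 0" by (simp add: hermitian_mat_def)
  then show ?case
    by (intro exI[of _ "1\<^sub>m 0"]) (auto simp: spectral_decomp_def intro!: unitary_matI eq_matI)
next
  case (Suc n A)
  let ?n = "Suc n"
  have A: "A \<in> carrier_mat ?n ?n" using Suc.prems by (simp add: hermitian_mat_def)
  obtain e where "eigenvalue A e"
    using spectrum_non_empty[OF A] by (auto simp: spectrum_def)
  then obtain v where v: "v \<in> carrier_vec ?n" "v \<noteq> 0\<^sub>v ?n" and Av: "A *\<^sub>v v = e \<cdot>\<^sub>v v"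
    using A by (auto simp: eigenvalue_def eigenvector_def)
  obtain W0 c where W0: "unitary_mat ?n W0" and col0: "col W0 0 = c \<cdot>\<^sub>v v"
    using exists_unitary_first_col[OF v] by metis
  have W0c: "W0 \<in> carrier_mat ?n ?n" "mat_adjoint W0 \<in> carrier_mat ?n ?n"
    and W0u: "mat_adjoint W0 * W0 = 1\<^sub>m ?n" "W0 * mat_adjoint W0 = 1\<^sub>m ?n"
    using W0 by (auto simp: unitary_mat_def)
  define B where "B = mat_adjoint W0 * A * W0"
  have Bh: "hermitian_mat ?n B" unfolding B_def
    by (rule hermitian_conjugate_unitary[OF Suc.prems W0c(1)])
  have Bc: "B \<in> carrier_mat ?n ?n" using Bh by (simp add: hermitian_mat_def)
  have A_eq: "A = W0 * B * mat_adjoint W0"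
  proof -
    have "W0 * B = W0 * (mat_adjoint W0 * A) * W0"
      unfolding B_def by (rule assoc_mult_mat[OF W0c(1) mult_carrier_mat[OF W0c(2) A] W0c(1), symmetric])
    also have "W0 * (mat_adjoint W0 * A) = A"
      unfolding assoc_mult_mat[OF W0c A, symmetric] W0u(2) using A by (rule left_mult_one_mat)
    finally have "W0 * B * mat_adjoint W0 = A * W0 * mat_adjoint W0" by simp
    also have "\<dots> = A * (W0 * mat_adjoint W0)" by (rule assoc_mult_mat[OF A W0c])
    also have "\<dots> = A" unfolding W0u(2) using A by (rule right_mult_one_mat)
    finally show ?thesis by (rule sym)
  qed
  have "col B 0 = e \<cdot>\<^sub>v unit_vec ?n 0"
  proof -
    have W0_0: "col W0 0 \<in> carrier_vec ?n" using v by (simp add: col0)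
    have "col B 0 = (mat_adjoint W0 * A) *\<^sub>v col W0 0"
      unfolding B_def using W0c A by (intro col_mult2[of _ ?n ?n _ ?n]) auto
    also have "\<dots> = mat_adjoint W0 *\<^sub>v (A *\<^sub>v col W0 0)"
      by (rule assoc_mult_mat_vec[OF W0c(2) A W0_0])
    also have "A *\<^sub>v col W0 0 = e \<cdot>\<^sub>v col W0 0"
      using A v Av by (simp add: col0 mult_mat_vec smult_smult_assoc mult.commute)
    also have "mat_adjoint W0 *\<^sub>v (e \<cdot>\<^sub>v col W0 0) = e \<cdot>\<^sub>v (mat_adjoint W0 *\<^sub>v col W0 0)"
      using W0c by (intro mult_mat_vec) auto
    also have "mat_adjoint W0 *\<^sub>v col W0 0 = col (mat_adjoint W0 * W0) 0"
      using W0c by (simp add: col_mult2[of _ ?n ?n _ ?n])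
    finally show ?thesis by (simp add: W0u)
  qed
  then have B0: "B $$ (i, 0) = (if i = 0 then e else 0)" if "i < ?n" for i
  proof -
    assume eq: "col B 0 = e \<cdot>\<^sub>v unit_vec ?n 0"
    have "B $$ (i, 0) = col B 0 $ i" using that Bc by simp
    then show ?thesis using that by (simp add: eq)
  qed
  \<comment> \<open>A diagonal entry of a Hermitian matrix is real, and this one is the
    eigenvalue.\<close>
  have e: "complex_of_real (Re e) = e"
  proof -
    have "cnj (B $$ (0, 0)) = B $$ (0, 0)" using hermitian_index[OF Bh, of 0 0] by simp
    then have "cnj e = e" using B0[of 0] by simp
    then show ?thesis by (simp add: complex_eq_iff)
  qed
  have "cnj e = e" by (metis e complex_cnj_complex_of_real)
  then have B0': "B $$ (0, i) = (if i = 0 then e else 0)" if "i < ?n" for i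
    using hermitian_index[OF Bh, of 0 i] B0[OF that] that by (cases "i = 0") auto
  define C where "C = mat n n (\<lambda>(i, j). B $$ (Suc i, Suc j))"
  have "hermitian_mat n C"
    by (auto simp: hermitian_mat_def C_def hermitian_index[OF Bh, symmetric] intro!: eq_matI)
  then obtain W1 p where W1: "spectral_decomp n C W1 p" using Suc.IH by blast
  have W1c: "unitary_mat n W1" "W1 \<in> carrier_mat n n" using W1
    by (auto simp: spectral_decomp_def unitary_mat_def)
  \<comment> \<open>The direct sum of the scalar 1 and \<open>W1\<close>: it leaves the eigenvector
    already split off in place.\<close>
  define W2 where "W2 = mat ?n ?n (\<lambda>(i, j). case i of 0 \<Rightarrow> (if j = 0 then 1 else 0)
       | Suc i' \<Rightarrow> (case j of 0 \<Rightarrow> 0 | Suc j' \<Rightarrow> W1 $$ (i', j')))"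
  have W2c: "W2 \<in> carrier_mat ?n ?n" by (simp add: W2_def)
  have W2i: "W2 $$ (0, 0) = 1" "\<And>i. i < n \<Longrightarrow> W2 $$ (Suc i, 0) = 0" "\<And>j. j < n \<Longrightarrow> W2 $$ (0, Suc j) = 0"
    "\<And>i j. i < n \<Longrightarrow> j < n \<Longrightarrow> W2 $$ (Suc i, Suc j) = W1 $$ (i, j)"
    by (auto simp: W2_def)
  have "mat_adjoint W2 * W2 = 1\<^sub>m ?n"
  proof (rule eq_matI)
    fix i j assume "i < dim_row (1\<^sub>m ?n :: complex mat)" "j < dim_col (1\<^sub>m ?n :: complex mat)"
    then have ij: "i < ?n" "j < ?n" by auto
    have "(mat_adjoint W2 * W2) $$ (i, j) = (\<Sum>k<?n. cnj (W2 $$ (k, i)) * W2 $$ (k, j))"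
      using W2c ij by (subst mult_index[of _ ?n ?n _ ?n]) auto
    also have "\<dots> = cnj (W2 $$ (0, i)) * W2 $$ (0, j) +
      (\<Sum>k<n. cnj (W2 $$ (Suc k, i)) * W2 $$ (Suc k, j))"
      by (rule sum.lessThan_Suc_shift)
    also have "\<dots> = 1\<^sub>m ?n $$ (i, j)"
      using ij unitary_mat_sum_col[OF W1c(1)] by (cases i; cases j) (auto simp: W2i)
    finally show "(mat_adjoint W2 * W2) $$ (i, j) = 1\<^sub>m ?n $$ (i, j)" .
  qed (use W2c in auto)
  then have W2: "unitary_mat ?n W2" using W2c by (intro unitary_matI)
  define q where "q i = (case i of 0 \<Rightarrow> Re e | Suc i' \<Rightarrow> p i')" for i
  have "spectral_decomp ?n B W2 q"
    unfolding spectral_decomp_def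
  proof (intro conjI allI impI Bc W2)
    fix i j assume ij: "i < ?n" "j < ?n"
    have "(\<Sum>k<?n. complex_of_real (q k) * W2 $$ (i, k) * cnj (W2 $$ (j, k))) =
      e * W2 $$ (i, 0) * cnj (W2 $$ (j, 0)) +
        (\<Sum>k<n. complex_of_real (p k) * W2 $$ (i, Suc k) * cnj (W2 $$ (j, Suc k)))"
      using e by (simp add: sum.lessThan_Suc_shift q_def del: sum.lessThan_Suc)
    also have "\<dots> = B $$ (i, j)"
    proof (cases "i = 0 \<or> j = 0")
      case True
      then show ?thesis using ij B0 B0' by (cases i; cases j) (auto simp: W2i)
    next
      case False
      then obtain i' j' where [simp]: "i = Suc i'" "j = Suc j'" by (cases i; cases j) auto
      have "B $$ (i, j) = C $$ (i', j')" using ij by (simp add: C_def)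
      also have "\<dots> = (\<Sum>k<n. complex_of_real (p k) * W1 $$ (i', k) * cnj (W1 $$ (j', k)))"
        using W1 ij by (auto simp: spectral_decomp_def)
      finally show ?thesis using ij by (simp add: W2i)
    qed
    finally show "B $$ (i, j) =
      (\<Sum>k<?n. complex_of_real (q k) * W2 $$ (i, k) * cnj (W2 $$ (j, k)))" by simp
  qed
  then have "B = W2 * mat ?n ?n (\<lambda>(i, j). if i =
    j then complex_of_real (q i) else 0) * mat_adjoint W2"
    (is "B = W2 * ?D * _")
    by (simp add: spectral_decomp_iff)
  then have "A = W0 * (W2 * ?D * mat_adjoint W2) * mat_adjoint W0" using A_eq by simp
  also have "\<dots> = (W0 * W2) * ?D * (mat_adjoint W2 * mat_adjoint W0)"
    by (rule mat_conj_conj[of _ ?n]) (use W0c W2c in auto)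
  finally have "A = (W0 * W2) * ?D * mat_adjoint (W0 * W2)"
    by (simp only: adjoint_mult[OF W0c(1) W2c])
  then have "spectral_decomp ?n A (W0 * W2) q"
    unfolding spectral_decomp_iff using A unitary_mat_mult[OF W0 W2] by blast
  then show ?case by blast
qed

section \<open>Functional calculus and the entropy of a sum of rank-one operators\<close>

text \<open>This is W diag(g) adj(W). For a fixed unitary \<open>W\<close>, products of such
  matrices correspond to pointwise products of the \<open>g\<close>, so a matrix, its projectors and
  all functions of it are computed with scalar functions.\<close>

definition spectral_comb :: "nat \<Rightarrow> complex mat \<Rightarrow> (nat \<Rightarrow> complex) \<Rightarrow> complex mat" where
  "spectral_comb d W g = mat d d (\<lambda>(i, j). \<Sum>l<d. g l * W $$ (i, l) * cnj (W $$ (j, l)))"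

text \<open>The entries of adj(W) v. Spectral combinations act diagonally in these coordinates, and
  vector identities are checked there.\<close>

definition coord :: "nat \<Rightarrow> complex mat \<Rightarrow> complex vec \<Rightarrow> nat \<Rightarrow> complex" where
  "coord d W v l = (\<Sum>i<d. cnj (W $$ (i, l)) * v $ i)"

lemma spectral_comb_carrier [simp]: "spectral_comb d W g \<in> carrier_mat d d"
  by (simp add: spectral_comb_def)

lemma spectral_decomp_eq_comb:
  "spectral_decomp d A W p \<Longrightarrow> A = spectral_comb d W (\<lambda>l. complex_of_real (p l))"
  by (auto simp: spectral_decomp_def spectral_comb_def intro!: eq_matI)

lemma spectral_comb_mult_vec:
  assumes "v \<in> carrier_vec d" "i < d"
  shows "(spectral_comb d W g *\<^sub>v v) $ i = (\<Sum>l<d. g l * W $$ (i, l) * coord d W v l)"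
proof -
  have "(spectral_comb d W g *\<^sub>v v) $ i =
    (\<Sum>j<d. (\<Sum>l<d. g l * W $$ (i, l) * cnj (W $$ (j, l))) * v $ j)"
    using assms by (subst mult_vec_index[of _ d d]) (auto simp: spectral_comb_def)
  also have "\<dots> = (\<Sum>j<d. \<Sum>l<d. g l * W $$ (i, l) * (cnj (W $$ (j, l)) * v $ j))"
    by (simp add: sum_distrib_right mult.assoc)
  also have "\<dots> = (\<Sum>l<d. g l * W $$ (i, l) * coord d W v l)"
    unfolding coord_def sum_distrib_left by (rule sum.swap)
  finally show ?thesis .
qed

lemma coord_spectral_comb:
  assumes W: "unitary_mat d W" and v: "v \<in> carrier_vec d" and l: "l < d"
  shows "coord d W (spectral_comb d W g *\<^sub>v v) l = g l * coord d W v l"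
proof -
  have "coord d W (spectral_comb d W g *\<^sub>v v) l =
      (\<Sum>i<d. cnj (W $$ (i, l)) * (\<Sum>k<d. g k * W $$ (i, k) * coord d W v k))"
    using v unfolding coord_def[of d W "_ *\<^sub>v _"]
      by (intro sum.cong) (auto simp: spectral_comb_mult_vec simp del: index_mult_mat_vec)
  also have "\<dots> = (\<Sum>i<d. \<Sum>k<d. g k * coord d W v k * (cnj (W $$ (i, l)) * W $$ (i, k)))"
    by (simp add: sum_distrib_left mult_ac)
  also have "\<dots> = (\<Sum>k<d. g k * coord d W v k * (\<Sum>i<d. cnj (W $$ (i, l)) * W $$ (i, k)))"
    unfolding sum_distrib_left by (rule sum.swap)
  also have "\<dots> = (\<Sum>k<d. if l = k then g k * coord d W v k else 0)"
    using unitary_mat_sum_col[OF W l] by (intro sum.cong) auto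
  finally show ?thesis using l by simp
qed

lemma coord_expansion:
  assumes W: "unitary_mat d W" and v: "v \<in> carrier_vec d" and i: "i < d"
  shows "(\<Sum>l<d. W $$ (i, l) * coord d W v l) = v $ i"
proof -
  have "(\<Sum>l<d. W $$ (i, l) * coord d W v l) = (\<Sum>l<d. \<Sum>j<d. v $ j * (W $$ (i, l) * cnj (W $$ (j, l))))"
    by (simp add: coord_def sum_distrib_left mult_ac)
  also have "\<dots> = (\<Sum>j<d. v $ j * (\<Sum>l<d. W $$ (i, l) * cnj (W $$ (j, l))))"
    unfolding sum_distrib_left by (rule sum.swap)
  also have "\<dots> = (\<Sum>j<d. if i = j then v $ j else 0)"
    using unitary_mat_sum_row[OF W i] by (intro sum.cong) auto
  finally show ?thesis using i by simp
qed

lemma coord_col: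
  assumes W: "unitary_mat d W" and "m < d" "l < d"
  shows "coord d W (col W l) m = (if m = l then 1 else 0)"
proof -
  have "W \<in> carrier_mat d d" using W by (simp add: unitary_mat_def)
  then show ?thesis using unitary_mat_sum_col[OF assms] assms(3) by (simp add: coord_def)
qed

lemma eq_vec_coord:
  assumes "unitary_mat d W" "v \<in> carrier_vec d" "w \<in> carrier_vec d"
    and "\<And>l. l < d \<Longrightarrow> coord d W v l = coord d W w l"
  shows "v = w"
proof (rule eq_vecI)
  fix i assume "i < dim_vec w"
  then have i: "i < d" using assms by simp
  have "v $ i = (\<Sum>l<d. W $$ (i, l) * coord d W v l)" using coord_expansion assms i by metis
  also have "\<dots> = (\<Sum>l<d. W $$ (i, l) * coord d W w l)" using assms by simp
  also have "\<dots> = w $ i" using coord_expansion assms i by metis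
  finally show "v $ i = w $ i" .
qed (use assms in auto)

lemma coord_smult: "v \<in> carrier_vec d \<Longrightarrow> coord d W (k \<cdot>\<^sub>v v) l = k * coord d W v l"
  by (auto simp: coord_def sum_distrib_left intro!: sum.cong)

lemma eq_mat_mult_vec:
  fixes A B :: "complex mat"
  assumes "A \<in> carrier_mat m n" "B \<in> carrier_mat m n"
    and "\<And>v. v \<in> carrier_vec n \<Longrightarrow> A *\<^sub>v v = B *\<^sub>v v"
  shows "A = B"
proof (rule eq_matI)
  fix i j assume "i < dim_row B" "j < dim_col B"
  then have ij: "i < m" "j < n" using assms by auto
  have *: "(C *\<^sub>v unit_vec n j) $ i = C $$ (i, j)" if "C \<in> carrier_mat m n" for C :: "complex mat"
  proof -
    have "(C *\<^sub>v unit_vec n j) $ i = (\<Sum>k<n. C $$ (i, k) * unit_vec n j $ k)"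
      using that ij by (intro mult_vec_index) auto
    also have "\<dots> = (\<Sum>k<n. if k = j then C $$ (i, k) else 0)" using ij by (intro sum.cong) auto
    finally show ?thesis using ij by simp
  qed
  show "A $$ (i, j) = B $$ (i, j)"
    using *[OF assms(1)] *[OF assms(2)] assms(3)[of "unit_vec n j"] by simp
qed (use assms in auto)

lemma spectral_comb_mult:
  assumes "unitary_mat d W"
  shows "spectral_comb d W g * spectral_comb d W h = spectral_comb d W (\<lambda>l. g l * h l)"
proof (rule eq_mat_mult_vec[of _ d d])
  fix v :: "complex vec" assume v: "v \<in> carrier_vec d"
  have c: "spectral_comb d W f *\<^sub>v u \<in> carrier_vec d" if "u \<in> carrier_vec d" for f u
    using that by (intro mult_mat_vec_carrier[of _ d d]) auto
  have "spectral_comb d W g * spectral_comb d W h *\<^sub>v v =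
    spectral_comb d W g *\<^sub>v (spectral_comb d W h *\<^sub>v v)"
    using v by (intro assoc_mult_mat_vec[of _ d d _ d]) auto
  also have "\<dots> = spectral_comb d W (\<lambda>l. g l * h l) *\<^sub>v v"
    using v c by (intro eq_vec_coord[OF assms]) (auto simp: coord_spectral_comb[OF assms])
  finally show "spectral_comb d W g * spectral_comb d W h *\<^sub>v v =
    spectral_comb d W (\<lambda>l. g l * h l) *\<^sub>v v" .
qed (auto intro: mult_carrier_mat[of _ d d])

lemma mat_trace_spectral_comb:
  assumes W: "unitary_mat d W"
  shows "mat_trace (spectral_comb d W g) = (\<Sum>l<d. g l)"
proof -
  have "mat_trace (spectral_comb d W g) = (\<Sum>i<d. \<Sum>l<d. g l * (cnj (W $$ (i, l)) * W $$ (i, l)))"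
    by (simp add: mat_trace_def spectral_comb_def mult_ac)
  also have "\<dots> = (\<Sum>l<d. g l * (\<Sum>i<d. cnj (W $$ (i, l)) * W $$ (i, l)))"
    unfolding sum_distrib_left by (rule sum.swap)
  also have "\<dots> = (\<Sum>l<d. g l)"
    using unitary_mat_sum_col[OF W] by (intro sum.cong) auto
  finally show ?thesis .
qed

text \<open>\<open>Q\<close> is the identity on its own range, which contains that of
  \<open>P\<close>.\<close>

lemma orth_projector_unique:
  assumes P: "hermitian_mat d P" "P * P = P" and Q: "hermitian_mat d Q" "Q * Q = Q"
    and range: "(\<lambda>v. P *\<^sub>v v) ` carrier_vec d \<subseteq> (\<lambda>v. Q *\<^sub>v v) ` carrier_vec d"
  shows "Q * P = P"
proof (rule eq_mat_mult_vec[of _ d d])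
  have c: "P \<in> carrier_mat d d" "Q \<in> carrier_mat d d" using P Q by (auto simp: hermitian_mat_def)
  fix v :: "complex vec" assume v: "v \<in> carrier_vec d"
  obtain w where w: "w \<in> carrier_vec d" "P *\<^sub>v v = Q *\<^sub>v w" using range v by blast
  have "Q * P *\<^sub>v v = Q *\<^sub>v (P *\<^sub>v v)" using c v by (intro assoc_mult_mat_vec[of _ d d _ d]) auto
  also have "\<dots> = Q * Q *\<^sub>v w" unfolding w(2) using c w
    by (intro assoc_mult_mat_vec[of _ d d _ d, symmetric]) auto
  also have "\<dots> = P *\<^sub>v v" by (simp add: Q w(2))
  finally show "Q * P *\<^sub>v v = P *\<^sub>v v" .
qed (use P Q in \<open>auto simp: hermitian_mat_def intro: mult_carrier_mat[of _ d d]\<close>)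

lemma orth_projector_eqI:
  assumes P: "hermitian_mat d P" "P * P = P" "(\<lambda>v. P *\<^sub>v v) ` carrier_vec d = E"
  shows "orth_projector d E = P"
  unfolding orth_projector_def
proof (rule the_equality)
  fix Q assume Q: "hermitian_mat d Q \<and> Q * Q = Q \<and> (\<lambda>v. Q *\<^sub>v v) ` carrier_vec d = E"
  have "Q * P = P" "P * Q = Q" using P Q by (auto intro!: orth_projector_unique)
  \<comment> \<open>Taking adjoints in Q P = P gives P Q = P, which together with P Q = Q identifies
    the two projectors.\<close>
  moreover have "mat_adjoint (Q * P) = P * Q"
    using P Q adjoint_mult[of Q d d P d] by (simp add: hermitian_mat_def)
  ultimately show "Q = P" using P by (simp add: hermitian_mat_def)
qed (use P in auto)

section \<open>Spectral data evaluated in an arbitrary decomposition\<close>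

context
  fixes d A W p
  assumes decomp: "spectral_decomp d A W p"
begin

lemma decomp_unitary: "unitary_mat d W" and decomp_carrier: "A \<in> carrier_mat d d"
  using decomp by (auto simp: spectral_decomp_def)

lemma coord_decomp: "v \<in> carrier_vec d \<Longrightarrow> l < d \<Longrightarrow> coord d W (A *\<^sub>v v) l =
  complex_of_real (p l) * coord d W v l"
  by (subst spectral_decomp_eq_comb[OF decomp]) (rule coord_spectral_comb[OF decomp_unitary])

lemma mem_eigenspace_iff:
  "v \<in> eigenspace A k \<longleftrightarrow> v \<in> carrier_vec d \<and> (\<forall>l<d. complex_of_real (p l) \<noteq> k \<longrightarrow> coord d W v l = 0)"
proof -
  have "A *\<^sub>v v = k \<cdot>\<^sub>v v \<longleftrightarrow> (\<forall>l<d. complex_of_real (p l) * coord d W v l = k * coord d W v l)"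
    if v: "v \<in> carrier_vec d"
  proof -
    have "A *\<^sub>v v = k \<cdot>\<^sub>v v \<longleftrightarrow> (\<forall>l<d. coord d W (A *\<^sub>v v) l = coord d W (k \<cdot>\<^sub>v v) l)"
      using v decomp_carrier eq_vec_coord[OF decomp_unitary, of "A *\<^sub>v v" "k \<cdot>\<^sub>v v"]
      by (auto intro: mult_mat_vec_carrier[of _ d d])
    then show ?thesis using v by (simp add: coord_decomp coord_smult)
  qed
  then show ?thesis using decomp_carrier by (auto simp: eigenspace_def)
qed

text \<open>In coordinates the eigenspace consists of the vectors supported on the indices with
  eigenvalue \<open>k\<close>, so the indicator of these indices gives the projector, whichever
  eigenbasis \<open>W\<close> was chosen.\<close>

lemma eigen_projector_eq:
  "eigen_projector A k = spectral_comb d W (\<lambda>l. if complex_of_real (p l) = k then 1 else 0)"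
  (is "_ = ?P")
proof -
  have "orth_projector d (eigenspace A k) = ?P"
  proof (rule orth_projector_eqI)
    show "hermitian_mat d ?P"
      by (auto simp: hermitian_mat_def spectral_comb_def mult_ac intro!: eq_matI sum.cong)
    show "?P * ?P = ?P"
      unfolding spectral_comb_mult[OF decomp_unitary]
        by (rule arg_cong[of _ _ "spectral_comb d W"]) auto
    have c: "?P *\<^sub>v v \<in> carrier_vec d" if "v \<in> carrier_vec d" for v
      using that by (intro mult_mat_vec_carrier[of _ d d]) auto
    show "(\<lambda>v. ?P *\<^sub>v v) ` carrier_vec d = eigenspace A k"
    proof (intro equalityI subsetI)
      fix w assume "w \<in> (\<lambda>v. ?P *\<^sub>v v) ` carrier_vec d"
      then show "w \<in> eigenspace A k"
        using c by (auto simp: mem_eigenspace_iff coord_spectral_comb[OF decomp_unitary])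
    next
      fix w assume w: "w \<in> eigenspace A k"
      then have wc: "w \<in> carrier_vec d" by (simp add: mem_eigenspace_iff)
      have "?P *\<^sub>v w = w"
        using w wc c by (intro eq_vec_coord[OF decomp_unitary])
          (auto simp: mem_eigenspace_iff coord_spectral_comb[OF decomp_unitary])
      then show "w \<in> (\<lambda>v. ?P *\<^sub>v v) ` carrier_vec d" using wc by (metis image_eqI)
    qed
  qed
  then show ?thesis using decomp_carrier by (simp add: eigen_projector_def)
qed

lemma spectrum_eq: "spectrum A = (\<lambda>l. complex_of_real (p l)) ` {..<d}"
proof (intro equalityI subsetI)
  fix k assume "k \<in> spectrum A"
  then obtain v where "v \<in> eigenspace A k" "v \<noteq> 0\<^sub>v d"
    using decomp_carrier by (auto simp: spectrum_def eigenvalue_def eigenvector_def eigenspace_def)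
  then have v: "v \<in> carrier_vec d" "\<And>l. l < d \<Longrightarrow> complex_of_real (p l) \<noteq> k \<Longrightarrow> coord d W v l =
    0" "v \<noteq> 0\<^sub>v d"
    by (auto simp: mem_eigenspace_iff)
  show "k \<in> (\<lambda>l. complex_of_real (p l)) ` {..<d}"
  proof (rule ccontr)
    assume "\<not> ?thesis"
    then have "v = 0\<^sub>v d"
      using v by (intro eq_vec_coord[OF decomp_unitary]) (auto simp: coord_def[of d W "0\<^sub>v d"])
    then show False using v by simp
  qed
next
  fix k assume "k \<in> (\<lambda>l. complex_of_real (p l)) ` {..<d}"
  then obtain l where l: "l < d" "k = complex_of_real (p l)" by auto
  have W: "W \<in> carrier_mat d d" using decomp_unitary by (simp add: unitary_mat_def)
  have coord: "coord d W (col W l) m = (if m = l then 1 else 0)" if "m < d" for m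
    by (rule coord_col[OF decomp_unitary that l(1)])
  have "col W l \<in> eigenspace A k" using W l by (auto simp: mem_eigenspace_iff coord)
  moreover have "col W l \<noteq> 0\<^sub>v d" using coord[OF l(1)] by (auto simp: coord_def)
  ultimately show "k \<in> spectrum A"
    using decomp_carrier by (auto simp: spectrum_def eigenvalue_def eigenvector_def eigenspace_def)
qed

lemma eigen_mult_eq: "eigen_mult A (complex_of_real x) = real (card {l. l < d \<and> p l = x})"
proof -
  have "{..<d} \<inter> {l. p l = x} = {l. l < d \<and> p l = x}" by auto
  then show ?thesis
    by (simp add: eigen_mult_def eigen_projector_eq mat_trace_spectral_comb[OF decomp_unitary]
      sum.If_cases)
qed

text \<open>The definition sums over distinct eigenvalues, the right-hand side over indices: after
  exchanging the sums, each index \<open>l\<close> is selected by exactly one member of the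
  spectrum.\<close>

lemma mat_fun_eq: "mat_fun f A = spectral_comb d W (\<lambda>l. complex_of_real (f (p l)))"
proof (rule eq_matI)
  fix i j assume "i < dim_row (spectral_comb d W (\<lambda>l. complex_of_real (f (p l))))"
    "j < dim_col (spectral_comb d W (\<lambda>l. complex_of_real (f (p l))))"
  then have ij: "i < d" "j < d" by (auto simp: spectral_comb_def)
  have "mat_fun f A $$ (i, j) = (\<Sum>k\<in>spectrum A. \<Sum>l<d. if complex_of_real (p l) = k then
      complex_of_real (f (p l)) * W $$ (i, l) * cnj (W $$ (j, l)) else 0)"
    using ij decomp_carrier
    by (auto simp: mat_fun_def eigen_projector_eq spectral_comb_def sum_distrib_left intro!: sum.cong)
  also have "\<dots> = (\<Sum>l<d. \<Sum>k\<in>spectrum A. if complex_of_real (p l) = k then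
      complex_of_real (f (p l)) * W $$ (i, l) * cnj (W $$ (j, l)) else 0)"
    by (rule sum.swap)
  also have "\<dots> = (\<Sum>l<d. complex_of_real (f (p l)) * W $$ (i, l) * cnj (W $$ (j, l)))"
    by (intro sum.cong refl) (simp add: spectrum_eq)
  finally show "mat_fun f A $$ (i, j) = spectral_comb d W (\<lambda>l. complex_of_real (f (p l))) $$ (i, j)"
    using ij by (simp add: spectral_comb_def)
qed (use decomp_carrier in \<open>auto simp: mat_fun_def spectral_comb_def\<close>)

lemma entropy_eq: "entropy A = - (\<Sum>l<d. p l * log 2 (p l))"
proof -
  have "A * mat_fun (log 2) A = spectral_comb d W (\<lambda>l. complex_of_real (p l * log 2 (p l)))"
    by (subst (1) spectral_decomp_eq_comb[OF decomp]) (simp add: mat_fun_eq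
      spectral_comb_mult[OF decomp_unitary])
  then show ?thesis by (simp add: entropy_def mat_trace_spectral_comb[OF decomp_unitary] del:
    of_real_mult)
qed

text \<open>Listing an eigenvalue once per index absorbs the factor \<open>eigen_mult\<close>; this
  puts \<open>Delta\<close> and the entropy over the same index set.\<close>

lemma Delta_eq: "Delta A = (\<Sum>l<d. p l * log 2 (real (card {m. m < d \<and> p m = p l})))"
proof -
  have "(\<Sum>l<d. p l * log 2 (real (card {m. m < d \<and> p m = p l}))) =
      (\<Sum>x\<in>p ` {..<d}. \<Sum>l\<in>{l \<in> {..<d}. p l = x}. p l * log 2 (real (card {m. m < d \<and> p m = p l})))"
    by (rule sum.image_gen) simp
  also have "\<dots> = (\<Sum>x\<in>p ` {..<d}. x * eigen_mult A (complex_of_real x) * log 2 (eigen_mult A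
    (complex_of_real x)))"
    by (intro sum.cong refl) (simp add: eigen_mult_eq)
  also have "\<dots> = Delta A"
    unfolding Delta_def spectrum_eq image_image[of complex_of_real p, symmetric]
    by (subst sum.reindex) (auto intro: inj_onI)
  finally show ?thesis by simp
qed

lemma mat_trace_decomp: "mat_trace A = complex_of_real (\<Sum>l<d. p l)"
  by (subst spectral_decomp_eq_comb[OF decomp]) (simp add: mat_trace_spectral_comb[OF decomp_unitary])

text \<open>The quadratic form takes the value \<open>p l\<close> at the unit eigenvector
  \<open>col W l\<close>.\<close>

lemma psd_decomp_nonneg:
  assumes "psd_mat d A" "l < d"
  shows "0 \<le> p l"
proof -
  have W: "W \<in> carrier_mat d d" using decomp_unitary by (simp add: unitary_mat_def)
  have v: "col W l \<in> carrier_vec d" using W assms by auto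
  have coord: "coord d W (col W l) m = (if m = l then 1 else 0)" if "m < d" for m
    by (rule coord_col[OF decomp_unitary that assms(2)])
  have "A *\<^sub>v col W l = complex_of_real (p l) \<cdot>\<^sub>v col W l"
  proof (rule eq_vec_coord[OF decomp_unitary])
    show "A *\<^sub>v col W l \<in> carrier_vec d" using decomp_carrier v
      by (intro mult_mat_vec_carrier[of _ d d]) auto
  qed (use v in \<open>auto simp: coord_decomp coord_smult coord\<close>)
  then have "(A *\<^sub>v col W l) \<bullet>c col W l =
    complex_of_real (p l) * (\<Sum>i<d. cnj (W $$ (i, l)) * W $$ (i, l))"
    using v W assms(2) by (auto simp: cscalar_prod_eq_sum[of _ d] sum_distrib_left mult_ac intro!:
      sum.cong)
  then have "(A *\<^sub>v col W l) \<bullet>c col W l = complex_of_real (p l)"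
    using unitary_mat_sum_col[OF decomp_unitary assms(2,2)] by simp
  then show ?thesis using assms v by (auto simp: psd_mat_def less_eq_complex_def)
qed

end

section \<open>Positivity and entropy of sums of rank-one operators\<close>

lemma psd_mat_sum_outer:
  assumes "M \<in> carrier_mat d d" 
    and M: "\<And>i j. i < d \<Longrightarrow> j < d \<Longrightarrow> M $$ (i, j) = (\<Sum>n\<in>N. x n i * cnj (x n j))"
  shows "psd_mat d M"
  unfolding psd_mat_def
proof (intro conjI ballI)
  show "hermitian_mat d M"
    using assms by (auto simp: hermitian_mat_def mult.commute intro!: eq_matI sum.cong)
  fix v :: "complex vec" assume v: "v \<in> carrier_vec d"
  \<comment> \<open>Moving the sum over \<open>n\<close> outside turns the quadratic form into a sum
    of squared moduli of inner products of \<open>x n\<close> with \<open>v\<close>.\<close>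
  have "(M *\<^sub>v v) \<bullet>c v = (\<Sum>i<d. (M *\<^sub>v v) $ i * cnj (v $ i))"
    using v assms by (intro cscalar_prod_eq_sum) (auto intro: mult_mat_vec_carrier[of _ d d])
  also have "\<dots> = (\<Sum>i<d. (\<Sum>j<d. M $$ (i, j) * v $ j) * cnj (v $ i))"
    using v assms by (intro sum.cong refl) (subst mult_vec_index[of _ d d], auto)
  also have "\<dots> = (\<Sum>i<d. \<Sum>j<d. \<Sum>n\<in>N. (x n i * cnj (v $ i)) * (cnj (x n j) * v $ j))"
    by (auto simp: M sum_distrib_left sum_distrib_right mult_ac intro!: sum.cong)
  also have "\<dots> = (\<Sum>n\<in>N. \<Sum>i<d. \<Sum>j<d. (x n i * cnj (v $ i)) * (cnj (x n j) * v $ j))"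
    by (subst sum.swap[of _ N]) (subst sum.swap[of _ N], rule refl)
  also have "\<dots> = (\<Sum>n\<in>N. (\<Sum>i<d. x n i * cnj (v $ i)) * cnj (\<Sum>j<d. x n j * cnj (v $ j)))"
    by (simp add: sum_product)
  also have "\<dots> = complex_of_real (\<Sum>n\<in>N. (cmod (\<Sum>i<d. x n i * cnj (v $ i)))\<^sup>2)"
    by (simp add: complex_mult_cnj cmod_power2 del: cnj_sum)
  finally show "0 \<le> (M *\<^sub>v v) \<bullet>c v" by (simp add: less_eq_complex_def sum_nonneg)
qed

text \<open>A Gibbs inequality. In an eigenbasis of \<open>M\<close>, the squared coordinates
  \<open>a n m\<close> sum over \<open>m\<close> to \<open>w n\<close> and over \<open>n\<close> to
  the eigenvalue \<open>\<mu> m\<close>. Using ln x \<le> x - 1 at the ratio of \<open>t n\<close>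
  to \<open>\<mu> m\<close>, with weight \<open>a n m\<close>, everything reduces to the bound 1 on
  the sum over \<open>m\<close> of \<open>a n m / \<mu> m\<close>, which expresses that each
  rank-one summand is dominated by \<open>M\<close>.\<close>

lemma entropy_sum_outer_le:
  fixes x :: "'n \<Rightarrow> nat \<Rightarrow> complex"
  assumes Mc: "M \<in> carrier_mat d d" and fin: "finite N"
    and M: "\<And>i j. i < d \<Longrightarrow> j < d \<Longrightarrow> M $$ (i, j) = (\<Sum>n\<in>N. x n i * cnj (x n j))"
    and w: "\<And>n. n \<in> N \<Longrightarrow> w n = (\<Sum>i<d. (cmod (x n i))\<^sup>2)"
    and t_nonneg: "\<And>n. n \<in> N \<Longrightarrow> 0 \<le> t n" and t_pos: "\<And>n. n \<in> N \<Longrightarrow> w n \<noteq> 0 \<Longrightarrow> t n \<noteq> 0"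
    and t_sum: "(\<Sum>n\<in>N. t n) \<le> (\<Sum>n\<in>N. w n)"
  shows "entropy M \<le> - (\<Sum>n\<in>N. w n * log 2 (t n))"
proof -
  have psd: "psd_mat d M" using Mc M by (rule psd_mat_sum_outer)
  then obtain W \<mu> where decomp: "spectral_decomp d M W \<mu>"
    using hermitian_spectral_decomp unfolding psd_mat_def by blast
  note W = decomp_unitary[OF decomp]
  have mu: "0 \<le> \<mu> m" if "m < d" for m using psd_decomp_nonneg[OF decomp psd that] .
  define c where "c n m = coord d W (vec d (x n)) m" for n m
  define a where "a n m = (cmod (c n m))\<^sup>2" for n m
  \<comment> \<open>The matrix of \<open>M\<close> in its own eigenbasis, computed once from the
    rank-one summands and once from the decomposition.\<close>
  have gram: "(\<Sum>n\<in>N. c n m * cnj (c n m')) = (if m = m' then complex_of_real (\<mu> m) else 0)"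
    if mm: "m < d" "m' < d" for m m'
  proof -
    have cm: "coord d W (M *\<^sub>v col W m') m = complex_of_real (\<mu> m) * coord d W (col W m') m"
      using W mm by (intro coord_decomp[OF decomp]) (auto simp: unitary_mat_def)
    have "coord d W (M *\<^sub>v col W m') m =
      (\<Sum>i<d. cnj (W $$ (i, m)) * (\<Sum>j<d. M $$ (i, j) * W $$ (j, m')))"
      unfolding coord_def using W mm Mc
      by (intro sum.cong refl) (subst mult_vec_index[of _ d d], auto simp: unitary_mat_def)
    also have "\<dots> = (\<Sum>i<d. \<Sum>j<d. \<Sum>n\<in>N. (cnj (W $$ (i, m)) * x n i) * (W $$ (j, m') * cnj (x n j)))"
      by (auto simp: M sum_distrib_left sum_distrib_right mult_ac intro!: sum.cong)
    also have "\<dots> = (\<Sum>n\<in>N. \<Sum>i<d. \<Sum>j<d. (cnj (W $$ (i, m)) * x n i) * (W $$ (j, m') * cnj (x n j)))"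
      by (subst sum.swap[of _ N]) (subst sum.swap[of _ N], rule refl)
    also have "\<dots> = (\<Sum>n\<in>N. c n m * cnj (c n m'))"
      by (simp add: c_def coord_def sum_product)
    finally have "(\<Sum>n\<in>N. c n m * cnj (c n m')) = complex_of_real (\<mu> m) * coord d W (col W m') m"
      using cm by simp
    also have "coord d W (col W m') m = (if m = m' then 1 else 0)"
      by (rule coord_col[OF W mm])
    finally show ?thesis by simp
  qed
  have a_sum: "(\<Sum>n\<in>N. a n m) = \<mu> m" if "m < d" for m
  proof -
    have "complex_of_real (\<Sum>n\<in>N. a n m) = (\<Sum>n\<in>N. c n m * cnj (c n m))"
      by (simp add: a_def complex_mult_cnj cmod_power2)
    then show ?thesis using gram[OF that that] by (metis of_real_eq_iff)
  qed
  have parseval: "(\<Sum>m<d. a n m) = w n" if "n \<in> N" for n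
  proof -
    have "complex_of_real (\<Sum>m<d. a n m) = (\<Sum>m<d. cnj (c n m) * c n m)"
      by (simp add: a_def complex_mult_cnj cmod_power2 mult.commute)
    also have "\<dots> = (\<Sum>m<d. \<Sum>i<d. cnj (x n i) * (W $$ (i, m) * c n m))"
      by (auto simp: c_def coord_def[of d W _ _] sum_distrib_right sum_distrib_left mult_ac intro!:
        sum.cong)
    also have "\<dots> = (\<Sum>i<d. cnj (x n i) * (\<Sum>m<d. W $$ (i, m) * c n m))"
      unfolding sum_distrib_left by (rule sum.swap)
    also have "\<dots> = (\<Sum>i<d. cnj (x n i) * x n i)"
      unfolding c_def by (intro sum.cong refl) (subst coord_expansion[OF W], auto)
    also have "\<dots> = complex_of_real (w n)"
      using w[OF that] by (simp add: complex_mult_cnj cmod_power2 mult.commute)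
    finally show ?thesis by (metis of_real_eq_iff)
  qed
  have a_nonneg: "0 \<le> a n m" for n m by (simp add: a_def)
  have a_zero: "a n m = 0" if "n \<in> N" "m < d" "\<mu> m = 0" for n m
    using a_sum[OF that(2)] that a_nonneg fin by (simp add: sum_nonneg_eq_0_iff)
  have bessel: "(\<Sum>m<d. a n m / \<mu> m) \<le> 1" if n: "n \<in> N" for n
  proof -
    define s where "s = (\<Sum>m<d. a n m / \<mu> m)"
    \<comment> \<open>Let C be the matrix of the \<open>c k m\<close>. By \<open>gram\<close>, C
      diag(1 / \<open>\<mu>\<close>) adj(C) is an orthogonal projection, where the convention 1 / 0
      = 0 makes the diagonal factor a pseudo-inverse. \<open>z\<close> is its column
      \<open>n\<close>; its squared norm equals its diagonal entry \<open>z n\<close>, which is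
      \<open>s\<close>, so s^2 \<le> s.\<close>
    define z where "z k = (\<Sum>m<d. cnj (c n m) / complex_of_real (\<mu> m) * c k m)" for k
    have zn: "z n = complex_of_real s"
      by (simp add: z_def s_def a_def complex_mult_cnj cmod_power2 mult.commute)
    have "complex_of_real (\<Sum>k\<in>N. (cmod (z k))\<^sup>2) = (\<Sum>k\<in>N. z k * cnj (z k))"
      by (simp add: complex_mult_cnj cmod_power2)
    also have "\<dots> = (\<Sum>k\<in>N. \<Sum>m<d. \<Sum>m'<d. cnj (c n m) / complex_of_real (\<mu> m) *
      (c n m' / complex_of_real (\<mu> m'))
        * (c k m * cnj (c k m')))"
      by (simp add: z_def sum_product mult_ac)
    also have "\<dots> = (\<Sum>m<d. \<Sum>m'<d. cnj (c n m) / complex_of_real (\<mu> m) *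
      (c n m' / complex_of_real (\<mu> m'))
        * (\<Sum>k\<in>N. c k m * cnj (c k m')))"
      unfolding sum_distrib_left by (subst sum.swap) (subst (2) sum.swap, rule refl)
    also have "\<dots> = (\<Sum>m<d. \<Sum>m'<d. if m =
      m' then cnj (c n m) / complex_of_real (\<mu> m) *
        (c n m' / complex_of_real (\<mu> m')) * complex_of_real (\<mu> m) else 0)"
      by (intro sum.cong refl) (simp add: gram)
    also have "\<dots> = complex_of_real s"
      by (auto simp: s_def a_def complex_mult_cnj cmod_power2 mult.commute intro!: sum.cong)
    finally have "(\<Sum>k\<in>N. (cmod (z k))\<^sup>2) = s" by (metis of_real_eq_iff)
    moreover have "(cmod (z n))\<^sup>2 \<le> (\<Sum>k\<in>N. (cmod (z k))\<^sup>2)"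
      using n fin by (intro member_le_sum) auto
    ultimately have "s * s \<le> s" by (simp add: zn power2_eq_square)
    then have "s \<le> 1" by (cases "s \<le> 0") (auto simp: mult_le_cancel_left1)
    then show ?thesis by (simp add: s_def)
  qed
  \<comment> \<open>If \<open>a n m\<close> is nonzero, then so are \<open>\<mu> m\<close> and
    \<open>w n\<close>, being sums of nonnegative terms that include it; hence both logarithms have
    positive arguments. Otherwise both sides vanish.\<close>
  have pointwise: "a n m * (ln (t n) - ln (\<mu> m)) \<le>
    t n * (a n m / \<mu> m) - a n m" if n: "n \<in> N" and m: "m < d" for n m
  proof (cases "a n m = 0")
    case False
    then have am: "a n m > 0" using a_nonneg[of n m] by simp
    have mu_pos: "\<mu> m > 0" using mu[OF m] a_zero[OF n m] False by fastforce
    have "w n \<noteq> 0"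
      using parseval[OF n] False m a_nonneg
        by (metis finite_lessThan lessThan_iff sum_nonneg_eq_0_iff)
    then have t: "t n > 0" using t_pos[OF n] t_nonneg[OF n] by simp
    have "ln (t n / \<mu> m) \<le> t n / \<mu> m - 1" using t mu_pos by (intro ln_le_minus_one) simp
    then have "a n m * (ln (t n) - ln (\<mu> m)) \<le> a n m * (t n / \<mu> m - 1)"
      using am t mu_pos by (intro mult_left_mono) (auto simp: ln_div)
    then show ?thesis by (simp add: algebra_simps)
  qed simp
  have "(\<Sum>n\<in>N. w n * ln (t n)) - (\<Sum>m<d. \<mu> m * ln (\<mu> m)) =
      (\<Sum>n\<in>N. \<Sum>m<d. a n m * ln (t n)) - (\<Sum>m<d. \<Sum>n\<in>N. a n m * ln (\<mu> m))"
    by (simp add: parseval a_sum flip: sum_distrib_right)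
  also have "\<dots> = (\<Sum>n\<in>N. \<Sum>m<d. a n m * (ln (t n) - ln (\<mu> m)))"
    by (subst sum.swap[of _ N "{..<d}"]) (simp add: right_diff_distrib sum_subtractf)
  also have "\<dots> \<le> (\<Sum>n\<in>N. \<Sum>m<d. t n * (a n m / \<mu> m) - a n m)"
    by (intro sum_mono pointwise) auto
  also have "\<dots> = (\<Sum>n\<in>N. t n * (\<Sum>m<d. a n m / \<mu> m) - w n)"
    by (intro sum.cong refl) (simp add: sum_subtractf sum_distrib_left parseval)
  also have "\<dots> \<le> (\<Sum>n\<in>N. t n * 1 - w n)"
    by (intro sum_mono diff_right_mono mult_left_mono bessel t_nonneg)
  also have "\<dots> \<le> 0" using t_sum by (simp add: sum_subtractf)
  finally have "(\<Sum>n\<in>N. w n * ln (t n)) \<le> (\<Sum>m<d. \<mu> m * ln (\<mu> m))" by simp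
  then have "(\<Sum>n\<in>N. w n * ln (t n)) / ln 2 \<le> (\<Sum>m<d. \<mu> m * ln (\<mu> m)) / ln 2"
    by (intro divide_right_mono) auto
  then show ?thesis
    by (simp add: entropy_eq[OF decomp] log_def sum_divide_distrib)
qed

section \<open>Channels driven by a diagonal catalyst\<close>

abbreviation real_diag :: "nat \<Rightarrow> (nat \<Rightarrow> real) \<Rightarrow> complex mat" where
  "real_diag d p \<equiv> mat d d (\<lambda>(i, j). if i = j then complex_of_real (p i) else 0)"

lemma sum_rotate3:
  "(\<Sum>a\<in>A. \<Sum>b\<in>B. \<Sum>c\<in>C. f a b c) = (\<Sum>b\<in>B. \<Sum>c\<in>C. \<Sum>a\<in>A. f a b c)"
  by (rule trans[OF sum.swap sum.cong[OF refl sum.swap]])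

lemma sum_rotate4:
  "(\<Sum>a\<in>A. \<Sum>b\<in>B. \<Sum>c\<in>C. \<Sum>d\<in>D. f a b c d) = (\<Sum>b\<in>B. \<Sum>c\<in>C. \<Sum>d\<in>D. \<Sum>a\<in>A. f a b c d)"
  by (rule trans[OF sum.swap sum.cong[OF refl sum_rotate3]])

section \<open>Tensor products in coordinates\<close>

lemma tensor_mat_index:
  assumes "A \<in> carrier_mat m n" "B \<in> carrier_mat m' n'" "a < m" "b < m'" "c < n" "e < n'"
  shows "tensor_mat A B $$ (a * m' + b, c * n' + e) = A $$ (a, c) * B $$ (b, e)"
  using assms by (simp add: tensor_mat_def pair_index_less)

lemma tensor_mat_carrier [simp]:
  "A \<in> carrier_mat m n \<Longrightarrow> B \<in> carrier_mat m' n' \<Longrightarrow> tensor_mat A B \<in> carrier_mat (m * m') (n * n')"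
  by (simp add: tensor_mat_def)

lemma eq_mat_pairI:
  assumes "A \<in> carrier_mat (m * m') (n * n')" "B \<in> carrier_mat (m * m') (n * n')"
    and "\<And>a b c e. a < m \<Longrightarrow> b < m' \<Longrightarrow> c < n \<Longrightarrow> e < n' \<Longrightarrow> A $$ (a * m' + b, c * n' + e) =
      B $$ (a * m' + b, c * n' + e)"
  shows "A = B"
proof (rule eq_matI)
  fix i j assume "i < dim_row B" "j < dim_col B"
  then have ij: "i < m * m'" "j < n * n'" using assms by auto
  then have pos: "m' > 0" "n' > 0" by (auto intro: Nat.gr0I)
  have "i div m' < m" "j div n' < n" using ij by (auto simp: less_mult_imp_div_less)
  then show "A $$ (i, j) = B $$ (i, j)"
    using assms(3)[of "i div m'" "i mod m'" "j div n'" "j mod n'"] pos by simp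
qed (use assms in auto)

lemma tensor_mat_mult:
  fixes A B C D :: "complex mat"
  assumes "A \<in> carrier_mat m n" "B \<in> carrier_mat m' n'" "C \<in> carrier_mat n p" "D \<in> carrier_mat n' p'"
  shows "tensor_mat A B * tensor_mat C D = tensor_mat (A * C) (B * D)"
proof (rule eq_mat_pairI)
  fix a b c e assume "a < m" "b < m'" "c < p" "e < p'"
  then show "(tensor_mat A B * tensor_mat C D) $$ (a * m' + b, c * p' + e) =
    tensor_mat (A * C) (B * D) $$ (a * m' + b, c * p' + e)"
    using assms
    by (simp add: mult_index[of _ "m * m'" "n * n'" _ "p * p'"] pair_index_less sum_lessThan_mult
        tensor_mat_index[of A m n B m' n'] tensor_mat_index[of C n p D n' p']
        tensor_mat_index[of "A * C" m p "B * D" m' p'] mult_index[of A m n C p]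
          mult_index[of B m' n' D p']
        sum_product mult_ac del: index_mult_mat(1))
qed (use assms in \<open>auto intro: mult_carrier_mat[of _ "m * m'" "n * n'"]\<close>)

lemma tensor_mat_adjoint:
  assumes "A \<in> carrier_mat m n" "B \<in> carrier_mat m' n'"
  shows "mat_adjoint (tensor_mat A B) = tensor_mat (mat_adjoint A) (mat_adjoint B)"
  by (rule eq_mat_pairI[of _ n n' m m'])
    (use assms in \<open>auto simp: tensor_mat_index[of _ m n _ m' n'] tensor_mat_index[of _ n m _ n' m'] 
      pair_index_less tensor_mat_def[THEN arg_cong, of dim_row]
        tensor_mat_def[THEN arg_cong, of dim_col]\<close>)

lemma tensor_mat_one: "tensor_mat (1\<^sub>m m) (1\<^sub>m n) = (1\<^sub>m (m * n) :: complex mat)"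
  by (rule eq_mat_pairI[of _ m n m n])
    (auto simp: tensor_mat_index[of _ m m _ n n] pair_index_less,
     (metis add_left_cancel div_mult_self3 div_less add_0 mod_mult_self3 mod_less
       less_nat_zero_code)+)

lemma unitary_mat_one: "unitary_mat d (1\<^sub>m d)"
  by (rule unitary_matI) (auto intro!: eq_matI)

lemma unitary_mat_tensor:
  assumes "unitary_mat m U" "unitary_mat n V"
  shows "unitary_mat (m * n) (tensor_mat U V)"
  using assms
  by (intro unitary_matI)
    (auto simp: unitary_mat_def tensor_mat_adjoint[of U m m V n n]
      tensor_mat_mult[of _ m m _ n n _ m _ n] tensor_mat_one)

lemma unitary_mat_pair_col:
  assumes "unitary_mat (dA * dB) U" "c < dA" "e < dB" "c' < dA" "e' < dB"
  shows "(\<Sum>a<dA. \<Sum>b<dB. U $$ (a * dB + b, c * dB + e) * cnj (U $$ (a * dB + b, c' * dB + e'))) =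
    (if c = c' \<and> e = e' then 1 else 0)"
proof -
  have "c' * dB + e' = c * dB + e \<longleftrightarrow> c = c' \<and> e = e'"
    using assms(3,5) by (metis div_mult_self3 div_less add_0 add.commute mod_mult_self3 mod_less
      less_nat_zero_code)
  then show ?thesis
    using unitary_mat_sum_col[OF assms(1) pair_index_less[OF assms(4,5)] pair_index_less[OF assms(2,3)]]
    by (simp add: sum_lessThan_mult mult.commute)
qed

text \<open>In terms of the blocks U_be, the inner double sum is the entry (a, a') of U_be X
  adj(U_b'e). Setting b = b' and summing gives the channel; setting a = a' and summing gives the
  returned catalyst.\<close>

lemma conj_tensor_diag_index:
  assumes U: "U \<in> carrier_mat (dA * dB) (dA * dB)" and X: "X \<in> carrier_mat dA dA"
    and ab: "a < dA" "b < dB" "a' < dA" "b' < dB"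
  shows "(U * tensor_mat X (real_diag dB l) * mat_adjoint U) $$ (a * dB + b, a' * dB + b') =
    (\<Sum>e<dB. complex_of_real (l e) * (\<Sum>c<dA. \<Sum>c'<dA.
       U $$ (a * dB + b, c * dB + e) * X $$ (c, c') * cnj (U $$ (a' * dB + b', c' * dB + e))))"
proof -
  let ?L = "real_diag dB l" and ?T = "tensor_mat X (real_diag dB l)"
  have "(U * ?T * mat_adjoint U) $$ (a * dB + b, a' * dB + b') =
    (\<Sum>c<dA. \<Sum>e<dB. \<Sum>c'<dA. \<Sum>e'<dB. U $$ (a * dB + b, c * dB + e) * ?T $$ (c * dB + e, c' * dB + e')
      * cnj (U $$ (a' * dB + b', c' * dB + e')))"
    using U X ab by (subst mat_conj_index[of _ "dA * dB"]) (auto simp: pair_index_less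
      sum_lessThan_mult)
  also have "\<dots> = (\<Sum>c<dA. \<Sum>e<dB. \<Sum>c'<dA. \<Sum>e'<dB. if e =
    e' then complex_of_real (l e) *
      (U $$ (a * dB + b, c * dB + e) * X $$ (c, c') * cnj (U $$ (a' * dB + b', c' * dB + e))) else 0)"
    using X by (intro sum.cong refl) (auto simp: tensor_mat_index[of X dA dA ?L dB dB])
  also have "\<dots> = (\<Sum>c<dA. \<Sum>e<dB. \<Sum>c'<dA. complex_of_real (l e) *
    (U $$ (a * dB + b, c * dB + e) * X $$ (c, c') * cnj (U $$ (a' * dB + b', c' * dB + e))))"
    by simp
  also have "\<dots> = (\<Sum>e<dB. \<Sum>c<dA. \<Sum>c'<dA. complex_of_real (l e) *
    (U $$ (a * dB + b, c * dB + e) * X $$ (c, c') * cnj (U $$ (a' * dB + b', c' * dB + e))))"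
    by (rule sum.swap)
  finally show ?thesis by (simp add: sum_distrib_left)
qed

text \<open>The formula is meaningful for every matrix and not only for states, so that the map can
  be compared with a given linear map on all arguments.\<close>

definition diag_channel :: "nat \<Rightarrow> nat \<Rightarrow> complex mat \<Rightarrow> (nat \<Rightarrow> real) \<Rightarrow> complex mat \<Rightarrow> complex mat" where
  "diag_channel dA dB U l X = ptrace_snd dA dB (U * tensor_mat X (real_diag dB l) * mat_adjoint U)"

lemma diag_channel_carrier [simp]: "diag_channel dA dB U l X \<in> carrier_mat dA dA"
  by (simp add: diag_channel_def ptrace_snd_def)

lemma diag_channel_dim [simp]:
  "dim_row (diag_channel dA dB U l X) = dA" "dim_col (diag_channel dA dB U l X) = dA"
  by (rule carrier_matD[OF diag_channel_carrier])+

lemma diag_channel_index: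
  assumes "U \<in> carrier_mat (dA * dB) (dA * dB)" "X \<in> carrier_mat dA dA" "a < dA" "a' < dA"
  shows "diag_channel dA dB U l X $$ (a, a') =
    (\<Sum>b<dB. \<Sum>e<dB. complex_of_real (l e) * (\<Sum>c<dA. \<Sum>c'<dA.
       U $$ (a * dB + b, c * dB + e) * X $$ (c, c') * cnj (U $$ (a' * dB + b, c' * dB + e))))"
  using assms by (simp add: diag_channel_def ptrace_snd_def conj_tensor_diag_index)

lemma diag_channel_add:
  assumes "U \<in> carrier_mat (dA * dB) (dA * dB)" "X \<in> carrier_mat dA dA" "Y \<in> carrier_mat dA dA"
  shows "diag_channel dA dB U l (X + Y) = diag_channel dA dB U l X + diag_channel dA dB U l Y"
proof (rule eq_matI)
  fix i j assume "i < dim_row (diag_channel dA dB U l X + diag_channel dA dB U l Y)"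
    "j < dim_col (diag_channel dA dB U l X + diag_channel dA dB U l Y)"
  then have "i < dA" "j < dA" by auto
  then show "diag_channel dA dB U l (X + Y) $$ (i, j) =
    (diag_channel dA dB U l X + diag_channel dA dB U l Y) $$ (i, j)"
    using assms
    by (simp add: diag_channel_index distrib_left distrib_right sum.distrib)
qed auto

lemma diag_channel_smult:
  assumes "U \<in> carrier_mat (dA * dB) (dA * dB)" "X \<in> carrier_mat dA dA"
  shows "diag_channel dA dB U l (k \<cdot>\<^sub>m X) = k \<cdot>\<^sub>m diag_channel dA dB U l X"
proof (rule eq_matI)
  fix i j assume "i < dim_row (k \<cdot>\<^sub>m diag_channel dA dB U l X)" "j < dim_col (k \<cdot>\<^sub>m diag_channel dA
    dB U l X)"
  then have "i < dA" "j < dA" by auto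
  then show "diag_channel dA dB U l (k \<cdot>\<^sub>m X) $$ (i, j) = (k \<cdot>\<^sub>m diag_channel dA dB U l X) $$ (i, j)"
    using assms
    by (simp add: diag_channel_index sum_distrib_left mult_ac)
qed auto

text \<open>Coordinate \<open>i\<close> of the Kraus operator sqrt(l e) <b|U|e>, acting on the
  second factor, applied to column \<open>k\<close> of \<open>Y\<close> scaled by sqrt(p k). The
  reference index \<open>i div dA\<close> is left alone, and \<open>i mod dA\<close> is the output
  index in A.\<close>

definition kraus_vec :: "nat \<Rightarrow> nat \<Rightarrow> complex mat \<Rightarrow> (nat \<Rightarrow> real) \<Rightarrow> complex mat \<Rightarrow> (nat \<Rightarrow> real) \<Rightarrow>
    nat \<times> nat \<times> nat \<Rightarrow> nat \<Rightarrow> complex" where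
  "kraus_vec dA dB U l Y p = (\<lambda>(b, e, k) i. complex_of_real (sqrt (l e * p k)) *
     (\<Sum>c<dA. U $$ ((i mod dA) * dB + b, c * dB + e) * Y $$ ((i div dA) * dA + c, k)))"

lemma id_tensor_diag_channel_index:
  assumes U: "U \<in> carrier_mat (dA * dB) (dA * dB)"
    and decomp: "spectral_decomp (dR * dA) \<rho> Y p"
    and p: "\<And>k. k < dR * dA \<Longrightarrow> 0 \<le> p k" and l: "\<And>e. e < dB \<Longrightarrow> 0 \<le> l e"
    and ij: "i < dR * dA" "j < dR * dA"
  shows "id_tensor dR dA (diag_channel dA dB U l) \<rho> $$ (i, j) =
    (\<Sum>n\<in>{..<dB} \<times> {..<dB} \<times> {..<dR * dA}. kraus_vec dA dB U l Y p n i * cnj (kraus_vec dA dB U l Y p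
      n j))"
proof -
  have dA: "0 < dA" using ij by (auto intro: Nat.gr0I)
  define r r' a a' where "r = i div dA" and "r' = j div dA" and "a = i mod dA" and "a' = j mod dA"
  have ra: "r < dR" "r' < dR" "a < dA" "a' < dA"
    using ij dA by (auto simp: r_def r'_def a_def a'_def less_mult_imp_div_less)
  have rho: "\<rho> $$ (r * dA + c, r' * dA + c') =
    (\<Sum>k<dR * dA. complex_of_real (p k) * Y $$ (r * dA + c, k) * cnj (Y $$ (r' * dA + c', k)))"
    if "c < dA" "c' < dA" for c c'
    using decomp that ra by (simp add: spectral_decomp_def pair_index_less)
  let ?u = "\<lambda>a b c e. U $$ (a * dB + b, c * dB + e)"
  let ?term = "\<lambda>b e k. complex_of_real (l e * p k) *
    (\<Sum>c<dA. \<Sum>c'<dA. (?u a b c e * Y $$ (r * dA + c, k)) *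
      (cnj (?u a' b c' e) * cnj (Y $$ (r' * dA + c', k))))"
  have "id_tensor dR dA (diag_channel dA dB U l) \<rho> $$ (i, j) =
    (\<Sum>b<dB. \<Sum>e<dB. complex_of_real (l e) *
      (\<Sum>c<dA. \<Sum>c'<dA. ?u a b c e * \<rho> $$ (r * dA + c, r' * dA + c') * cnj (?u a' b c' e)))"
    using ij ra U
    by (simp add: id_tensor_def r_def[symmetric] r'_def[symmetric] a_def[symmetric]
      a'_def[symmetric] diag_channel_index)
  also have "\<dots> = (\<Sum>b<dB. \<Sum>e<dB. complex_of_real (l e) * (\<Sum>c<dA. \<Sum>c'<dA. ?u a b c e *
      (\<Sum>k<dR * dA. complex_of_real (p k) * Y $$ (r * dA + c, k) * cnj (Y $$ (r' * dA + c', k))) *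
        cnj (?u a' b c' e)))"
    by (intro sum.cong refl arg_cong2[of _ _ _ _ "(*)"]) (simp add: rho)
  also have "\<dots> = (\<Sum>b<dB. \<Sum>e<dB. \<Sum>c<dA. \<Sum>c'<dA. \<Sum>k<dR * dA.
      complex_of_real (l e * p k) * ((?u a b c e * Y $$ (r * dA + c, k)) *
        (cnj (?u a' b c' e) * cnj (Y $$ (r' * dA + c', k)))))"
    by (simp add: sum_distrib_left sum_distrib_right mult_ac)
  also have "\<dots> = (\<Sum>b<dB. \<Sum>e<dB. \<Sum>k<dR * dA. ?term b e k)"
    unfolding sum_distrib_left
    by (rule sum.cong[OF refl], rule sum.cong[OF refl], rule sum_rotate3[symmetric])
  also have "\<dots> = (\<Sum>b<dB. \<Sum>e<dB. \<Sum>k<dR * dA. kraus_vec dA dB U l Y p (b, e, k) i * cnj (kraus_vec dA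
    dB U l Y p (b, e, k) j))"
  proof (intro sum.cong refl)
    fix b e k assume "b \<in> {..<dB}" "e \<in> {..<dB}" "k \<in> {..<dR * dA}"
    then have "0 \<le> l e * p k" using p l by auto
    \<comment> \<open>The nonnegative weight is split evenly between the vector and its
      conjugate.\<close>
    then have sq: "complex_of_real (l e * p k) =
      complex_of_real (sqrt (l e * p k)) * complex_of_real (sqrt (l e * p k))"
      by (metis of_real_mult real_sqrt_mult_self abs_of_nonneg)
    show "?term b e k = kraus_vec dA dB U l Y p (b, e, k) i * cnj (kraus_vec dA dB U l Y p (b, e, k)
      j)"
      unfolding sq kraus_vec_def r_def[symmetric] r'_def[symmetric] a_def[symmetric]
        a'_def[symmetric] prod.case sum_product[symmetric]
      by (simp add: mult_ac)
  qed
  finally show ?thesis by (simp add: sum.cartesian_product)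
qed

lemma id_tensor_carrier [simp]: "id_tensor d1 d2 \<Phi> X \<in> carrier_mat (d1 * d2) (d1 * d2)"
  by (simp add: id_tensor_def)

text \<open>Trace preservation is orthonormality of the columns of \<open>U\<close>, averaged with
  the weights \<open>l e\<close>. Complete positivity holds because, for every reference dimension,
  a positive input yields a sum of rank-one terms.\<close>

lemma quantum_map_diag_channel:
  assumes U: "unitary_mat (dA * dB) U" and l: "\<And>e. e < dB \<Longrightarrow> 0 \<le> l e" and l_sum: "(\<Sum>e<dB. l e) = 1"
  shows "quantum_map dA (diag_channel dA dB U l)"
proof -
  have Uc: "U \<in> carrier_mat (dA * dB) (dA * dB)" using U by (simp add: unitary_mat_def)
  have tr: "mat_trace (diag_channel dA dB U l X) = mat_trace X" if X: "X \<in> carrier_mat dA dA" for X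
  proof -
    let ?u = "\<lambda>a b c e. U $$ (a * dB + b, c * dB + e)"
    have "mat_trace (diag_channel dA dB U l X) = (\<Sum>a<dA. \<Sum>b<dB. \<Sum>e<dB. \<Sum>c<dA. \<Sum>c'<dA.
        complex_of_real (l e) * X $$ (c, c') * (?u a b c e * cnj (?u a b c' e)))"
      using X Uc
      by (simp add: mat_trace_def diag_channel_index sum_distrib_left mult_ac)
    also have "\<dots> = (\<Sum>e<dB. \<Sum>c<dA. \<Sum>c'<dA. complex_of_real (l e) * X $$ (c, c') *
        (\<Sum>a<dA. \<Sum>b<dB. ?u a b c e * cnj (?u a b c' e)))"
      unfolding sum_distrib_left
      by (rule trans[OF sum.cong[OF refl sum_rotate4] sum_rotate4])
    also have "\<dots> = (\<Sum>e<dB. \<Sum>c<dA. \<Sum>c'<dA. if c = c' then complex_of_real (l e) * X $$ (c, c') else 0)"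
      by (intro sum.cong refl) (simp add: unitary_mat_pair_col[OF U])
    also have "\<dots> = complex_of_real (\<Sum>e<dB. l e) * mat_trace X"
      using X by (simp add: mat_trace_def sum_product)
    finally show ?thesis using l_sum by simp
  qed
  have psd: "psd_mat (dR * dA) (id_tensor dR dA (diag_channel dA dB U l) X)" if X: "psd_mat (dR *
    dA) X" for dR X
  proof -
    obtain Y p where decomp: "spectral_decomp (dR * dA) X Y p"
      using X hermitian_spectral_decomp unfolding psd_mat_def by blast
    show ?thesis
      by (rule psd_mat_sum_outer, simp, rule id_tensor_diag_channel_index[OF Uc decomp])
        (auto intro: psd_decomp_nonneg[OF decomp X] l)
  qed
  show ?thesis
    unfolding quantum_map_def
    using tr psd diag_channel_add[OF Uc] diag_channel_smult[OF Uc] by auto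
qed

text \<open>For fixed \<open>e\<close> the blocks <b|U|e>, stacked over \<open>b\<close>, form an
  isometry. Hence summing over \<open>b\<close> returns the squared norm of the scaled eigenvector;
  the individual weights depend on \<open>U\<close>.\<close>

lemma kraus_vec_weight:
  assumes U: "unitary_mat (dA * dB) U" and Y: "unitary_mat (dR * dA) Y"
    and ek: "e < dB" "k < dR * dA" and nonneg: "0 \<le> l e" "0 \<le> p k"
  shows "(\<Sum>b<dB. \<Sum>i<dR * dA. (cmod (kraus_vec dA dB U l Y p (b, e, k) i))\<^sup>2) = l e * p k"
proof -
  let ?u = "\<lambda>a b c. U $$ (a * dB + b, c * dB + e)"
  let ?y = "\<lambda>r c. Y $$ (r * dA + c, k)"
  let ?K = "\<lambda>b i. kraus_vec dA dB U l Y p (b, e, k) i"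
  have sq: "complex_of_real (sqrt (l e * p k)) * complex_of_real (sqrt (l e * p k)) =
    complex_of_real (l e * p k)"
    using nonneg by (metis of_real_mult real_sqrt_mult_self abs_of_nonneg mult_nonneg_nonneg)
  have K: "?K b (r * dA + a) * cnj (?K b (r * dA + a)) = complex_of_real (l e * p k) *
      (\<Sum>c<dA. \<Sum>c'<dA. (?y r c * cnj (?y r c')) * (?u a b c * cnj (?u a b c')))" if "a < dA" for a b r
  proof -
    have "?K b (r * dA + a) * cnj (?K b (r * dA + a)) =
      complex_of_real (sqrt (l e * p k)) * complex_of_real (sqrt (l e * p k)) *
      ((\<Sum>c<dA. ?u a b c * ?y r c) * (\<Sum>c<dA. cnj (?u a b c) * cnj (?y r c)))"
      using that by (simp add: kraus_vec_def mult_ac)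
    then show ?thesis unfolding sq sum_product by (simp add: mult_ac)
  qed
  have "complex_of_real (\<Sum>b<dB. \<Sum>i<dR * dA. (cmod (?K b i))\<^sup>2) =
    (\<Sum>b<dB. \<Sum>i<dR * dA. ?K b i * cnj (?K b i))"
    by (simp add: complex_mult_cnj cmod_power2)
  also have "\<dots> = (\<Sum>b<dB. \<Sum>r<dR. \<Sum>a<dA. complex_of_real (l e * p k) *
      (\<Sum>c<dA. \<Sum>c'<dA. (?y r c * cnj (?y r c')) * (?u a b c * cnj (?u a b c'))))"
    by (auto simp: sum_lessThan_mult K intro!: sum.cong)
  also have "\<dots> = complex_of_real (l e * p k) * (\<Sum>r<dR. \<Sum>a<dA. \<Sum>b<dB. \<Sum>c<dA. \<Sum>c'<dA.
      (?y r c * cnj (?y r c')) * (?u a b c * cnj (?u a b c')))"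
    unfolding sum_distrib_left by (subst sum.swap) (subst (2) sum.swap, rule refl)
  also have "(\<Sum>r<dR. \<Sum>a<dA. \<Sum>b<dB. \<Sum>c<dA. \<Sum>c'<dA. (?y r c * cnj (?y r c')) *
    (?u a b c * cnj (?u a b c'))) =
     (\<Sum>r<dR. \<Sum>c<dA. \<Sum>c'<dA. (?y r c * cnj (?y r c')) * (\<Sum>a<dA. \<Sum>b<dB. ?u a b c * cnj (?u a b c')))"
    unfolding sum_distrib_left
    by (rule sum.cong[OF refl], rule trans[OF sum.cong[OF refl sum_rotate3] sum_rotate3])
  also have "\<dots> = (\<Sum>r<dR. \<Sum>c<dA. \<Sum>c'<dA. if c = c' then ?y r c * cnj (?y r c') else 0)"
    by (intro sum.cong refl) (simp add: unitary_mat_pair_col[OF U] ek)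
  also have "\<dots> = (\<Sum>i<dR * dA. cnj (Y $$ (i, k)) * Y $$ (i, k))"
    by (simp add: sum_lessThan_mult) (simp add: mult.commute)
  also have "\<dots> = 1" using unitary_mat_sum_col[OF Y ek(2,2)] by simp
  finally show ?thesis by (metis of_real_eq_iff mult.right_neutral)
qed

section \<open>Extension from states by linearity, and rotation of the catalyst\<close>

lemma id_tensor_cong:
  assumes "\<And>X. X \<in> carrier_mat d2 d2 \<Longrightarrow> \<Phi> X = \<Psi> X"
  shows "id_tensor d1 d2 \<Phi> X = id_tensor d1 d2 \<Psi> X"
  using assms by (auto simp: id_tensor_def intro!: eq_matI)

text \<open>States span all matrices: outer products are multiples of states, matrix units are
  combinations of outer products. This is what carries the condition in
  \<open>catalytic_map\<close>, stated for states only, over to the blocks on which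
  \<open>id_tensor\<close> evaluates the map.\<close>

lemma linear_eq_on_states:
  fixes \<Phi> \<Psi> :: "complex mat \<Rightarrow> complex mat"
  assumes carr: "\<And>X. X \<in> carrier_mat d d \<Longrightarrow> \<Phi> X \<in> carrier_mat d d" "\<And>X. X \<in> carrier_mat d d \<Longrightarrow>
    \<Psi> X \<in> carrier_mat d d"
    and add: "\<And>X Y. X \<in> carrier_mat d d \<Longrightarrow> Y \<in> carrier_mat d d \<Longrightarrow> \<Phi> (X + Y) = \<Phi> X + \<Phi> Y"
      "\<And>X Y. X \<in> carrier_mat d d \<Longrightarrow> Y \<in> carrier_mat d d \<Longrightarrow> \<Psi> (X + Y) = \<Psi> X + \<Psi> Y"
    and smult: "\<And>X k. X \<in> carrier_mat d d \<Longrightarrow> \<Phi> (k \<cdot>\<^sub>m X) = k \<cdot>\<^sub>m \<Phi> X"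
      "\<And>X k. X \<in> carrier_mat d d \<Longrightarrow> \<Psi> (k \<cdot>\<^sub>m X) = k \<cdot>\<^sub>m \<Psi> X"
    and states: "\<And>\<rho>. quantum_state d \<rho> \<Longrightarrow> \<Phi> \<rho> = \<Psi> \<rho>"
    and X: "X \<in> carrier_mat d d"
  shows "\<Phi> X = \<Psi> X"
proof -
  define P where "P M \<longleftrightarrow> M \<in> carrier_mat d d \<and> \<Phi> M = \<Psi> M" for M
  have P_add: "P (M + N)" if "P M" "P N" for M N using that add by (auto simp: P_def)
  have P_smult: "P (k \<cdot>\<^sub>m M)" if "P M" for k M using that smult by (auto simp: P_def)
  have P_zero: "P (0\<^sub>m d d)"
  proof -
    have z: "0 \<cdot>\<^sub>m M = 0\<^sub>m d d" if "M \<in> carrier_mat d d" for M :: "complex mat"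
      using that by (intro eq_matI) auto
    have "\<Phi> (0\<^sub>m d d) = 0\<^sub>m d d" "\<Psi> (0\<^sub>m d d) = 0\<^sub>m d d"
      using smult[of "0\<^sub>m d d" 0] carr[of "0\<^sub>m d d"] z by (metis zero_carrier_mat)+
    then show ?thesis by (simp add: P_def)
  qed
  have P_outer: "P (mat d d (\<lambda>(i, j). v i * cnj (v j)))" (is "P ?M") for v
  proof -
    define s where "s = (\<Sum>i<d. (cmod (v i))\<^sup>2)"
    have s0: "0 \<le> s" by (simp add: s_def sum_nonneg)
    show ?thesis
    proof (cases "s = 0")
      case True
      then have "v i = 0" if "i < d" for i using that by (simp add: s_def sum_nonneg_eq_0_iff)
      then have "?M = 0\<^sub>m d d" by (intro eq_matI) auto
      then show ?thesis using P_zero by simp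
    next
      case False
      then have s: "0 < s" using s0 by simp
      \<comment> \<open>A nonzero outer product is a positive multiple of a state; the zero one
        cannot be normalised and was treated apart.\<close>
      define \<rho> where "\<rho> = complex_of_real (1 / s) \<cdot>\<^sub>m ?M"
      have sq: "complex_of_real (1 / s) = complex_of_real (1 / sqrt s) * complex_of_real (1 / sqrt s)"
        using s by (simp add: of_real_mult[symmetric] del: of_real_mult)
      have "psd_mat d \<rho>"
        by (rule psd_mat_sum_outer[where N = "{()}" and x = "\<lambda>_ i. complex_of_real (1 / sqrt s) * v i"])
          (auto simp: \<rho>_def sq mult_ac simp del: of_real_divide)
      moreover have "mat_trace \<rho> = complex_of_real (1 / s) * (\<Sum>i<d. v i * cnj (v i))"
        by (simp add: mat_trace_def \<rho>_def sum_distrib_left del: of_real_divide)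
      moreover have "(\<Sum>i<d. v i * cnj (v i)) = complex_of_real s"
        by (simp add: s_def complex_mult_cnj cmod_power2)
      ultimately have "quantum_state d \<rho>" using s by (simp add: quantum_state_def)
      then have "P \<rho>" using states by (auto simp: P_def \<rho>_def)
      then have "P (complex_of_real s \<cdot>\<^sub>m \<rho>)" by (rule P_smult)
      moreover have "complex_of_real s \<cdot>\<^sub>m \<rho> = ?M" using s by (intro eq_matI) (auto simp: \<rho>_def)
      ultimately show ?thesis by simp
    qed
  qed
  have P_unit: "P (mat d d (\<lambda>(k, m). if k = i \<and> m = j then 1 else 0))" (is "P ?E") for i j
  proof -
    define v where "v z k = (if k = i then 1 else 0) + z * (if k = j then 1 else 0 :: complex)"
      for z k
    define M where "M z = mat d d (\<lambda>(k, m). v z k * cnj (v z m))" for z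
    \<comment> \<open>Polarisation: averaging z times the outer product of e_i + z e_j over the four
      fourth roots of unity z removes every term except the matrix unit (i, j).\<close>
    have "P (1/4 \<cdot>\<^sub>m (M 1 + - 1 \<cdot>\<^sub>m M (- 1) + \<i> \<cdot>\<^sub>m M \<i> + - \<i> \<cdot>\<^sub>m M (- \<i>)))"
      unfolding M_def by (intro P_smult P_add P_outer)
    moreover have "1/4 \<cdot>\<^sub>m (M 1 + - 1 \<cdot>\<^sub>m M (- 1) + \<i> \<cdot>\<^sub>m M \<i> + - \<i> \<cdot>\<^sub>m M (- \<i>)) = ?E"
      by (intro eq_matI) (auto simp: M_def v_def algebra_simps)
    ultimately show ?thesis by simp
  qed
  \<comment> \<open>The entries of \<open>X\<close> are added one at a time in row order; the entry
    number n sits in row n div d and column n mod d.\<close>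
  have "P (mat d d (\<lambda>(i, j). if i * d + j < n then X $$ (i, j) else 0))" for n
  proof (induction n)
    case 0
    have "mat d d (\<lambda>(i, j). if i * d + j < 0 then X $$ (i, j) else 0) = 0\<^sub>m d d"
      by (intro eq_matI) auto
    then show ?case using P_zero by (simp only:)
  next
    case (Suc n)
    let ?M = "\<lambda>n. mat d d (\<lambda>(i, j). if i * d + j < n then X $$ (i, j) else 0)"
    let ?E = "mat d d (\<lambda>(k, m). if k = n div d \<and> m = n mod d then 1 else 0)"
    have iff: "k * d + m = n \<longleftrightarrow> k = n div d \<and> m = n mod d" if "m < d" for k m
      using that by auto
    have "?M (Suc n) = ?M n + X $$ (n div d, n mod d) \<cdot>\<^sub>m ?E"
      by (intro eq_matI) (auto simp: less_Suc_eq iff)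
    then show ?case using P_add[OF Suc.IH P_smult[OF P_unit]] by simp
  qed
  from this[of "d * d"] have "P X"
  proof -
    assume *: "P (mat d d (\<lambda>(i, j). if i * d + j < d * d then X $$ (i, j) else 0))"
    have "mat d d (\<lambda>(i, j). if i * d + j < d * d then X $$ (i, j) else 0) = X"
      using X by (intro eq_matI) (auto simp: pair_index_less)
    then show ?thesis using * by simp
  qed
  then show ?thesis by (simp add: P_def)
qed

text \<open>The rotation of the catalyst is absorbed by replacing \<open>U\<close> with U (1 tensor
  W) and \<open>V\<close> with V W. Used with an eigenbasis and with its adjoint, it exchanges a
  catalyst with its diagonal form in both directions.\<close>

lemma catalytic_map_conj:
  assumes W: "unitary_mat dB W" and \<tau>: "\<tau> \<in> carrier_mat dB dB"
    and cat: "catalytic_map dA dB (W * \<tau> * mat_adjoint W) \<Phi>"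
  shows "catalytic_map dA dB \<tau> \<Phi>"
proof -
  obtain U V where U: "unitary_mat (dA * dB) U" and V: "unitary_mat dB V"
    and UV: "\<And>\<rho>. quantum_state dA \<rho> \<Longrightarrow>
      ptrace_snd dA dB (U * tensor_mat \<rho> (W * \<tau> * mat_adjoint W) * mat_adjoint U) = \<Phi> \<rho> \<and>
      ptrace_fst dA dB (U * tensor_mat \<rho> (W * \<tau> * mat_adjoint W) * mat_adjoint U) =
        V * (W * \<tau> * mat_adjoint W) * mat_adjoint V"
    using cat by (auto simp: catalytic_map_def)
  have Wc: "W \<in> carrier_mat dB dB" "mat_adjoint W \<in> carrier_mat dB dB" using W
    by (auto simp: unitary_mat_def)
  have Vc: "V \<in> carrier_mat dB dB" "mat_adjoint V \<in> carrier_mat dB dB" using V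
    by (auto simp: unitary_mat_def)
  have Uc: "U \<in> carrier_mat (dA * dB) (dA * dB)" "mat_adjoint U \<in> carrier_mat (dA * dB) (dA * dB)"
    using U by (auto simp: unitary_mat_def)
  let ?W = "tensor_mat (1\<^sub>m dA) W"
  have W': "unitary_mat (dA * dB) ?W" by (rule unitary_mat_tensor[OF unitary_mat_one W])
  then have W'c: "?W \<in> carrier_mat (dA * dB) (dA * dB)" by (simp add: unitary_mat_def)
  have one: "mat_adjoint (1\<^sub>m dA) = (1\<^sub>m dA :: complex mat)" by (intro eq_matI) auto
  have V': "V * (W * \<tau> * mat_adjoint W) * mat_adjoint V = (V * W) * \<tau> * mat_adjoint (V * W)"
    unfolding adjoint_mult[OF Vc(1) Wc(1)] by (rule mat_conj_conj[of _ dB]) (use Vc Wc \<tau> in auto)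
  have U': "U * tensor_mat \<rho> (W * \<tau> * mat_adjoint W) * mat_adjoint U =
    (U * ?W) * tensor_mat \<rho> \<tau> * mat_adjoint (U * ?W)"
    if "quantum_state dA \<rho>" for \<rho>
  proof -
    have \<rho>: "\<rho> \<in> carrier_mat dA dA" using that
      by (auto simp: quantum_state_def psd_mat_def hermitian_mat_def)
    have "tensor_mat \<rho> (W * \<tau> * mat_adjoint W) =
      tensor_mat (1\<^sub>m dA * \<rho> * 1\<^sub>m dA) (W * \<tau> * mat_adjoint W)"
      using \<rho> by simp
    also have "\<dots> = tensor_mat (1\<^sub>m dA * \<rho>) (W * \<tau>) * tensor_mat (1\<^sub>m dA) (mat_adjoint W)"
      using \<rho> Wc \<tau> by (intro tensor_mat_mult[symmetric, of _ dA dA _ dB dB _ dA _ dB]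
        mult_carrier_mat[of _ _ dA] mult_carrier_mat[of _ _ dB]) auto
    also have "tensor_mat (1\<^sub>m dA * \<rho>) (W * \<tau>) = ?W * tensor_mat \<rho> \<tau>"
      using \<rho> Wc \<tau> by (intro tensor_mat_mult[symmetric, of _ dA dA _ dB dB _ dA _ dB]) auto
    also have "tensor_mat (1\<^sub>m dA) (mat_adjoint W) = mat_adjoint ?W"
      using Wc by (simp add: tensor_mat_adjoint[of _ dA dA _ dB dB] one)
    finally show ?thesis
      unfolding adjoint_mult[OF Uc(1) W'c]
      using mat_conj_conj[OF Uc(1) W'c, of "tensor_mat \<rho> \<tau>" "mat_adjoint ?W" "mat_adjoint U"] Uc W'c
        \<rho> \<tau> by simp
  qed
  have "ptrace_snd dA dB ((U * ?W) * tensor_mat \<rho> \<tau> * mat_adjoint (U * ?W)) = \<Phi> \<rho> \<and>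
      ptrace_fst dA dB ((U * ?W) * tensor_mat \<rho> \<tau> * mat_adjoint (U * ?W)) =
        (V * W) * \<tau> * mat_adjoint (V * W)"
    if "quantum_state dA \<rho>" for \<rho>
    using UV[OF that] unfolding U'[OF that] V' .
  then show ?thesis
    using cat unitary_mat_mult[OF U W'] unitary_mat_mult[OF V W] unfolding catalytic_map_def by blast
qed

section \<open>The upper bound\<close>

lemma local_conj_index:
  assumes V: "V \<in> carrier_mat n n" and M: "M \<in> carrier_mat (m * n) (m * n)"
    and ab: "a < m" "b < n" "a' < m" "b' < n"
  shows "(tensor_mat (1\<^sub>m m) V * M * mat_adjoint (tensor_mat (1\<^sub>m m) V)) $$ (a * n + b, a' * n + b') =
    (\<Sum>k<n. \<Sum>k'<n. V $$ (b, k) * M $$ (a * n + k, a' * n + k') * cnj (V $$ (b', k')))"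
proof -
  let ?T = "tensor_mat (1\<^sub>m m) V"
  have pull: "(\<Sum>i\<in>S. if P then f i else 0) = (if P then \<Sum>i\<in>S. f i else 0)"
    for S :: "nat set" and P and f :: "nat \<Rightarrow> complex"
    by simp
  have "(?T * M * mat_adjoint ?T) $$ (a * n + b, a' * n + b') =
    (\<Sum>c<m. \<Sum>k<n. \<Sum>c'<m. \<Sum>k'<n. ?T $$ (a * n + b, c * n + k) * M $$ (c * n + k, c' * n + k') * cnj
      (?T $$ (a' * n + b', c' * n + k')))"
    using V M ab by (subst mat_conj_index[of _ "m * n"]) (auto simp: pair_index_less
      sum_lessThan_mult)
  also have "\<dots> = (\<Sum>c<m. \<Sum>k<n. \<Sum>c'<m. \<Sum>k'<n. if a = c then if a' =
    c' then V $$ (b, k) * M $$ (c * n + k, c' * n + k') * cnj (V $$ (b', k')) else 0 else 0)"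
    using V ab by (intro sum.cong refl) (auto simp: tensor_mat_index[of _ m m V n n])
  also have "\<dots> = (\<Sum>c<m. if a = c then \<Sum>k<n. \<Sum>c'<m. if a' =
    c' then \<Sum>k'<n. V $$ (b, k) * M $$ (c * n + k, c' * n + k') * cnj (V $$ (b', k')) else 0 else 0)"
    by (simp only: pull)
  also have "\<dots> = (\<Sum>k<n. \<Sum>k'<n. V $$ (b, k) * M $$ (a * n + k, a' * n + k') * cnj (V $$ (b', k')))"
    using ab by simp
  finally show ?thesis .
qed

text \<open>Together with \<open>ptrace_snd_local_conj\<close> this permits undoing the final
  rotation of the catalyst inside the unitary, without changing the channel.\<close>

lemma ptrace_fst_local_conj:
  assumes V: "V \<in> carrier_mat n n" and M: "M \<in> carrier_mat (m * n) (m * n)"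
  shows "ptrace_fst m n (tensor_mat (1\<^sub>m m) V * M * mat_adjoint (tensor_mat (1\<^sub>m m) V)) =
    V * ptrace_fst m n M * mat_adjoint V"
proof (rule eq_matI)
  fix b b' assume "b < dim_row (V * ptrace_fst m n M * mat_adjoint V)" "b' < dim_col (V * ptrace_fst
    m n M * mat_adjoint V)"
  then have b: "b < n" "b' < n" using V by auto
  have "ptrace_fst m n (tensor_mat (1\<^sub>m m) V * M * mat_adjoint (tensor_mat (1\<^sub>m m) V)) $$ (b, b') =
    (\<Sum>a<m. \<Sum>k<n. \<Sum>k'<n. V $$ (b, k) * M $$ (a * n + k, a * n + k') * cnj (V $$ (b', k')))"
    using b by (simp add: ptrace_fst_def local_conj_index[OF V M] del: index_mult_mat(1))
  also have "\<dots> = (\<Sum>k<n. \<Sum>k'<n. \<Sum>a<m. V $$ (b, k) * M $$ (a * n + k, a * n + k') * cnj (V $$ (b',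
    k')))"
    by (rule sum_rotate3)
  also have "\<dots> = (V * ptrace_fst m n M * mat_adjoint V) $$ (b, b')"
    using V b by (subst mat_conj_index[of _ n]) (auto simp: ptrace_fst_def sum_distrib_left
      sum_distrib_right)
  finally show "ptrace_fst m n (tensor_mat (1\<^sub>m m) V * M * mat_adjoint (tensor_mat (1\<^sub>m m) V)) $$
    (b, b') =
     (V * ptrace_fst m n M * mat_adjoint V) $$ (b, b')" .
qed (use V in \<open>auto simp: ptrace_fst_def\<close>)

lemma ptrace_snd_local_conj:
  assumes V: "unitary_mat n V" and M: "M \<in> carrier_mat (m * n) (m * n)"
  shows "ptrace_snd m n (tensor_mat (1\<^sub>m m) V * M * mat_adjoint (tensor_mat (1\<^sub>m m) V)) =
    ptrace_snd m n M"
proof (rule eq_matI)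
  have Vc: "V \<in> carrier_mat n n" using V by (simp add: unitary_mat_def)
  fix a a' assume "a < dim_row (ptrace_snd m n M)" "a' < dim_col (ptrace_snd m n M)"
  then have a: "a < m" "a' < m" by (auto simp: ptrace_snd_def)
  have "ptrace_snd m n (tensor_mat (1\<^sub>m m) V * M * mat_adjoint (tensor_mat (1\<^sub>m m) V)) $$ (a, a') =
    (\<Sum>b<n. \<Sum>k<n. \<Sum>k'<n. M $$ (a * n + k, a' * n + k') * (cnj (V $$ (b, k')) * V $$ (b, k)))"
    using a by (simp add: ptrace_snd_def local_conj_index[OF Vc M] mult_ac del: index_mult_mat(1))
  also have "\<dots> = (\<Sum>k<n. \<Sum>k'<n. M $$ (a * n + k, a' * n + k') *
    (\<Sum>b<n. cnj (V $$ (b, k')) * V $$ (b, k)))"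
    unfolding sum_distrib_left by (rule sum_rotate3)
  also have "\<dots> = (\<Sum>k<n. \<Sum>k'<n. if k' = k then M $$ (a * n + k, a' * n + k') else 0)"
    by (intro sum.cong refl) (simp add: unitary_mat_sum_col[OF V])
  also have "\<dots> = ptrace_snd m n M $$ (a, a')" using a by (simp add: ptrace_snd_def)
  finally show "ptrace_snd m n (tensor_mat (1\<^sub>m m) V * M * mat_adjoint (tensor_mat (1\<^sub>m m) V)) $$
    (a, a') =
     ptrace_snd m n M $$ (a, a')" .
qed (auto simp: ptrace_snd_def)

text \<open>Expanding the square, the sum of D b e (l b - l e)^2 over all pairs is twice the sum of
  squares of \<open>l\<close> minus twice the pairing of \<open>l\<close> with D l, hence zero. Its
  terms are nonnegative, so each vanishes.\<close>

lemma doubly_stochastic_fixed_point: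
  fixes D :: "'a \<Rightarrow> 'a \<Rightarrow> real" and l :: "'a \<Rightarrow> real"
  assumes fin: "finite S" and nonneg: "\<And>b e. b \<in> S \<Longrightarrow> e \<in> S \<Longrightarrow> 0 \<le> D b e"
    and rows: "\<And>b. b \<in> S \<Longrightarrow> (\<Sum>e\<in>S. D b e) = 1" and cols: "\<And>e. e \<in> S \<Longrightarrow> (\<Sum>b\<in>S. D b e) = 1"
    and fixed: "\<And>b. b \<in> S \<Longrightarrow> (\<Sum>e\<in>S. D b e * l e) = l b"
    and be: "b \<in> S" "e \<in> S" "l b \<noteq> l e"
  shows "D b e = 0"
proof -
  have "(\<Sum>b\<in>S. \<Sum>e\<in>S. D b e * (l b - l e)\<^sup>2) =
      (\<Sum>b\<in>S. \<Sum>e\<in>S. D b e * (l b)\<^sup>2) + (\<Sum>b\<in>S. \<Sum>e\<in>S. D b e * (l e)\<^sup>2) - 2 * (\<Sum>b\<in>S. \<Sum>e\<in>S. l b *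
        (D b e * l e))"
    by (simp add: power2_diff algebra_simps sum.distrib sum_subtractf sum_distrib_left)
  also have "(\<Sum>b\<in>S. \<Sum>e\<in>S. D b e * (l b)\<^sup>2) = (\<Sum>b\<in>S. (l b)\<^sup>2)"
    by (simp add: sum_distrib_right[symmetric] rows)
  also have "(\<Sum>b\<in>S. \<Sum>e\<in>S. D b e * (l e)\<^sup>2) = (\<Sum>e\<in>S. (l e)\<^sup>2)"
    by (subst sum.swap) (simp add: sum_distrib_right[symmetric] cols)
  also have "(\<Sum>b\<in>S. \<Sum>e\<in>S. l b * (D b e * l e)) = (\<Sum>b\<in>S. (l b)\<^sup>2)"
    by (simp add: sum_distrib_left[symmetric] fixed power2_eq_square)
  finally have total: "(\<Sum>b\<in>S. \<Sum>e\<in>S. D b e * (l b - l e)\<^sup>2) = 0" by simp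
  have "(\<Sum>e\<in>S. D b e * (l b - l e)\<^sup>2) = 0"
    using total be nonneg fin by (subst (asm) sum_nonneg_eq_0_iff) (auto intro!: sum_nonneg)
  then have "D b e * (l b - l e)\<^sup>2 = 0"
    using be nonneg fin by (subst (asm) sum_nonneg_eq_0_iff) auto
  then show ?thesis using be by simp
qed

lemma unitary_mat_pair_row:
  assumes "unitary_mat (dA * dB) U" "a < dA" "b < dB"
  shows "(\<Sum>c<dA. \<Sum>e<dB. (cmod (U $$ (a * dB + b, c * dB + e)))\<^sup>2) = 1"
proof -
  have "complex_of_real (\<Sum>c<dA. \<Sum>e<dB. (cmod (U $$ (a * dB + b, c * dB + e)))\<^sup>2) =
    (\<Sum>k<dA * dB. U $$ (a * dB + b, k) * cnj (U $$ (a * dB + b, k)))"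
    by (simp add: sum_lessThan_mult complex_mult_cnj cmod_power2)
  also have "\<dots> = 1" using unitary_mat_sum_row[OF assms(1)] pair_index_less[OF assms(2,3)] by simp
  finally show ?thesis by (metis of_real_eq_1_iff)
qed

lemma quantum_state_maximally_mixed:
  assumes "0 < d"
  shows "quantum_state d (complex_of_real (1 / real d) \<cdot>\<^sub>m 1\<^sub>m d)"
  unfolding quantum_state_def
proof
  show "psd_mat d (complex_of_real (1 / real d) \<cdot>\<^sub>m 1\<^sub>m d)"
  proof (rule psd_mat_sum_outer[where N = "{..<d}" and x = "\<lambda>n i. if i = n then complex_of_real (1 / sqrt (real d)) else 0"])
    fix i j assume "i < d" "j < d"
    let ?s = "complex_of_real (1 / sqrt (real d))"
    have "complex_of_real (1 / real d) = ?s * ?s"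
      by (simp only: of_real_mult[symmetric]) simp
    moreover have "(\<Sum>n<d. (if i = n then ?s else 0) * cnj (if j = n then ?s else 0)) =
        (\<Sum>n<d. if i = n then if i = j then ?s * ?s else 0 else 0)"
      by (intro sum.cong refl) auto
    ultimately show "(complex_of_real (1 / real d) \<cdot>\<^sub>m 1\<^sub>m d) $$ (i, j) =
      (\<Sum>n<d. (if i = n then complex_of_real (1 / sqrt (real d)) else 0) * cnj (if j =
        n then complex_of_real (1 / sqrt (real d)) else 0))"
      using \<open>i < d\<close> \<open>j < d\<close> by (simp del: of_real_divide)
  qed auto
  show "mat_trace (complex_of_real (1 / real d) \<cdot>\<^sub>m 1\<^sub>m d) = 1"
    using assms by (simp add: mat_trace_def)
qed

text \<open>Averaging over the catalyst condition for the maximally mixed input makes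
  \<open>\<Sum>a c. |U(ab,ce)|\<^sup>2 / d\<^sub>A\<close> a doubly stochastic matrix which fixes the eigenvalues of the catalyst.\<close>

lemma catalytic_unitary_block_diagonal:
  assumes U: "unitary_mat (dA * dB) U"
    and catalyst: "\<And>\<rho>. quantum_state dA \<rho> \<Longrightarrow>
      ptrace_fst dA dB (U * tensor_mat \<rho> (real_diag dB l) * mat_adjoint U) = real_diag dB l"
    and ind: "a < dA" "b < dB" "c < dA" "e < dB" and neq: "l b \<noteq> l e"
  shows "U $$ (a * dB + b, c * dB + e) = 0"
proof -
  have Uc: "U \<in> carrier_mat (dA * dB) (dA * dB)" using U by (simp add: unitary_mat_def)
  let ?m = "complex_of_real (1 / real dA) \<cdot>\<^sub>m 1\<^sub>m dA :: complex mat"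
  define D where "D b e = (\<Sum>a<dA. \<Sum>c<dA. (cmod (U $$ (a * dB + b, c * dB + e)))\<^sup>2) / real dA" for b e
  have "D b e = 0"
  proof (rule doubly_stochastic_fixed_point[of "{..<dB}" D l])
    \<comment> \<open>Each of the \<open>dA\<close> rows of \<open>U\<close> with catalyst index
      \<open>b\<close> has norm one, and the divisor in \<open>D\<close> averages over them; the
      columns behave in the same way.\<close>
    show "(\<Sum>e<dB. D b e) = 1" if "b \<in> {..<dB}" for b
    proof -
      have "(\<Sum>e<dB. D b e) =
        (\<Sum>a<dA. \<Sum>c<dA. \<Sum>e<dB. (cmod (U $$ (a * dB + b, c * dB + e)))\<^sup>2) / real dA"
        unfolding D_def sum_divide_distrib[symmetric] by (subst sum_rotate3) simp
      also have "\<dots> = 1" using that ind by (simp add: unitary_mat_pair_row[OF U])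
      finally show ?thesis .
    qed
    show "(\<Sum>b<dB. D b e) = 1" if "e \<in> {..<dB}" for e
    proof -
      have col: "(\<Sum>a<dA. \<Sum>b<dB. (cmod (U $$ (a * dB + b, c * dB + e)))\<^sup>2) = 1" if "c < dA" for c
      proof -
        have "complex_of_real (\<Sum>a<dA. \<Sum>b<dB. (cmod (U $$ (a * dB + b, c * dB + e)))\<^sup>2) =
          (\<Sum>a<dA. \<Sum>b<dB. U $$ (a * dB + b, c * dB + e) * cnj (U $$ (a * dB + b, c * dB + e)))"
          by (simp add: complex_mult_cnj cmod_power2)
        also have "\<dots> = 1" using that \<open>e \<in> {..<dB}\<close> by (subst unitary_mat_pair_col[OF U]) auto
        finally show ?thesis by (metis of_real_eq_1_iff)
      qed
      have "(\<Sum>b<dB. D b e) =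
        (\<Sum>b<dB. \<Sum>a<dA. \<Sum>c<dA. (cmod (U $$ (a * dB + b, c * dB + e)))\<^sup>2) / real dA"
        unfolding D_def sum_divide_distrib[symmetric] ..
      also have "(\<Sum>b<dB. \<Sum>a<dA. \<Sum>c<dA. (cmod (U $$ (a * dB + b, c * dB + e)))\<^sup>2) =
        (\<Sum>c<dA. \<Sum>a<dA. \<Sum>b<dB. (cmod (U $$ (a * dB + b, c * dB + e)))\<^sup>2)"
        by (rule trans[OF sum_rotate3 trans[OF sum.swap]]) simp
      also have "\<dots> = real dA" by (simp add: col)
      finally show ?thesis using ind by simp
    qed
    show "(\<Sum>e<dB. D b e * l e) = l b" if "b \<in> {..<dB}" for b
    proof -
      have b: "b < dB" using that by simp
      have "complex_of_real (l b) =
        ptrace_fst dA dB (U * tensor_mat ?m (real_diag dB l) * mat_adjoint U) $$ (b, b)"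
        using catalyst[OF quantum_state_maximally_mixed[of dA]] ind b by simp
      also have "\<dots> = (\<Sum>a<dA. \<Sum>e<dB. complex_of_real (l e) * (\<Sum>c<dA. \<Sum>c'<dA.
         U $$ (a * dB + b, c * dB + e) * ?m $$ (c, c') * cnj (U $$ (a * dB + b, c' * dB + e))))"
        using b by (simp add: ptrace_fst_def conj_tensor_diag_index[OF Uc] del: index_mult_mat(1)
          index_smult_mat(1))
      also have "\<dots> = (\<Sum>a<dA. \<Sum>e<dB. complex_of_real (l e) * (\<Sum>c<dA. \<Sum>c'<dA. if c = c' then
         complex_of_real (1 / real dA) *
           (U $$ (a * dB + b, c * dB + e) * cnj (U $$ (a * dB + b, c * dB + e))) else 0))"
        by (intro sum.cong refl arg_cong2[of _ _ _ _ "(*)"]) auto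
      also have "\<dots> = complex_of_real (\<Sum>a<dA. \<Sum>e<dB. l e * (\<Sum>c<dA. 1 / real dA *
        (cmod (U $$ (a * dB + b, c * dB + e)))\<^sup>2))"
        by (simp add: complex_mult_cnj cmod_power2 sum_distrib_left)
      finally have "l b = (\<Sum>a<dA. \<Sum>e<dB. l e * (\<Sum>c<dA. 1 / real dA *
        (cmod (U $$ (a * dB + b, c * dB + e)))\<^sup>2))"
        by (simp only: of_real_eq_iff)
      also have "\<dots> = (\<Sum>e<dB. \<Sum>a<dA. l e * (\<Sum>c<dA. 1 / real dA *
        (cmod (U $$ (a * dB + b, c * dB + e)))\<^sup>2))"
        by (rule sum.swap)
      also have "\<dots> = (\<Sum>e<dB. D b e * l e)"
        by (simp add: D_def sum_distrib_left sum_distrib_right sum_divide_distrib mult_ac)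
      finally show ?thesis by simp
    qed
  qed (use ind neq in \<open>auto simp: D_def intro!: sum_nonneg divide_nonneg_nonneg\<close>)
  then have "(\<Sum>a<dA. \<Sum>c<dA. (cmod (U $$ (a * dB + b, c * dB + e)))\<^sup>2) = 0" using ind
    by (simp add: D_def)
  then have "(\<Sum>c<dA. (cmod (U $$ (a * dB + b, c * dB + e)))\<^sup>2) = 0"
    using ind by (subst (asm) sum_nonneg_eq_0_iff) (auto intro!: sum_nonneg)
  then have "(cmod (U $$ (a * dB + b, c * dB + e)))\<^sup>2 = 0"
    using ind by (subst (asm) sum_nonneg_eq_0_iff) auto
  then show ?thesis by simp
qed

section \<open>Multiplicities and the resulting entropy bound\<close>

definition multiplicity_of :: "nat \<Rightarrow> (nat \<Rightarrow> real) \<Rightarrow> nat \<Rightarrow> real" where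
  "multiplicity_of d l e = real (card {m. m < d \<and> l m = l e})"

lemma multiplicity_of_pos: "e < d \<Longrightarrow> 0 < multiplicity_of d l e"
  by (auto simp: multiplicity_of_def card_gt_0_iff)

text \<open>Equal shares within one eigenspace add up to the whole. This normalises the comparison
  distribution below and later evaluates the entropy of the extremal output.\<close>

lemma sum_same_eigenvalue:
  "e < d \<Longrightarrow> (\<Sum>b<d. if l b = l e then x / multiplicity_of d l e else 0) = x"
proof -
  assume "e < d"
  have "{..<d} \<inter> {b. l b = l e} = {m. m < d \<and> l m = l e}" by auto
  then have "(\<Sum>b<d. if l b = l e then x / multiplicity_of d l e else 0) =
    multiplicity_of d l e * (x / multiplicity_of d l e)"
    by (simp add: sum.If_cases) (simp add: multiplicity_of_def)
  then show ?thesis using multiplicity_of_pos[OF \<open>e < d\<close>, of l] by simp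
qed

text \<open>The right-hand side is the Shannon entropy of the distribution giving probability
  \<open>l e / multiplicity_of d l e\<close> to each pair (b, e) with \<open>l b = l e\<close>.
  Vanishing eigenvalues are treated apart because the logarithm of the quotient splits only for
  positive arguments.\<close>

lemma entropy_plus_Delta_eq:
  assumes decomp: "spectral_decomp d A W l" and nonneg: "\<And>e. e < d \<Longrightarrow> 0 \<le> l e"
  shows "entropy A + Delta A = - (\<Sum>e<d. l e * log 2 (l e / multiplicity_of d l e))"
proof -
  have "l e * log 2 (l e / multiplicity_of d l e) =
    l e * log 2 (l e) - l e * log 2 (multiplicity_of d l e)"
    if "e < d" for e
    using nonneg[OF that] multiplicity_of_pos[OF that, of l]
    by (cases "l e = 0") (auto simp: log_divide right_diff_distrib)
  then show ?thesis
    by (simp add: entropy_eq[OF decomp] Delta_eq[OF decomp] multiplicity_of_def[symmetric]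
      sum_subtractf)
qed

text \<open>The individual weights \<open>w (b, e, k)\<close> depend on \<open>U\<close>, but on
  their support the logarithm of \<open>t\<close> does not depend on \<open>b\<close>. So only their
  sums over \<open>b\<close> enter the cross entropy, and these are \<open>l e * p k\<close> for
  every \<open>U\<close>.\<close>

lemma entropy_diag_channel_le:
  assumes U: "unitary_mat (dA * dB) U"
    and block: "\<And>a b c e. a < dA \<Longrightarrow> b < dB \<Longrightarrow> c < dA \<Longrightarrow> e < dB \<Longrightarrow> l b \<noteq> l e \<Longrightarrow>
      U $$ (a * dB + b, c * dB + e) = 0"
    and l: "\<And>e. e < dB \<Longrightarrow> 0 \<le> l e" and l_sum: "(\<Sum>e<dB. l e) = 1"
    and \<rho>: "quantum_state (dR * dA) \<rho>"
  shows "entropy (id_tensor dR dA (diag_channel dA dB U l) \<rho>) \<le>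
    entropy \<rho> - (\<Sum>e<dB. l e * log 2 (l e / multiplicity_of dB l e))"
proof -
  have Uc: "U \<in> carrier_mat (dA * dB) (dA * dB)" using U by (simp add: unitary_mat_def)
  have psd: "psd_mat (dR * dA) \<rho>" using \<rho> by (simp add: quantum_state_def)
  then obtain Y p where decomp: "spectral_decomp (dR * dA) \<rho> Y p"
    using hermitian_spectral_decomp unfolding psd_mat_def by blast
  note Y = decomp_unitary[OF decomp]
  have p: "0 \<le> p k" if "k < dR * dA" for k using psd_decomp_nonneg[OF decomp psd that] .
  have "complex_of_real (\<Sum>k<dR * dA. p k) = 1"
    using \<rho> mat_trace_decomp[OF decomp] by (simp add: quantum_state_def)
  then have p_sum: "(\<Sum>k<dR * dA. p k) = 1" by (metis of_real_eq_1_iff)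
  define K where "K = kraus_vec dA dB U l Y p"
  define N where "N = {..<dB} \<times> {..<dB} \<times> {..<dR * dA}"
  define w where "w n = (\<Sum>i<dR * dA. (cmod (K n i))\<^sup>2)" for n
  \<comment> \<open>The total weight of (e, k) is shared equally among the values of
    \<open>b\<close> that the block condition admits.\<close>
  define t where "t = (\<lambda>(b, e, k). if l b = l e then l e / multiplicity_of dB l e * p k else 0)"
  \<comment> \<open>The sum over \<open>b\<close> is placed innermost, since the weights are known
    only after summing over it.\<close>
  have sum_N: "(\<Sum>n\<in>N. f n) = (\<Sum>e<dB. \<Sum>k<dR * dA. \<Sum>b<dB. f (b, e, k))"
    for f :: "nat \<times> nat \<times> nat \<Rightarrow> real"
    unfolding N_def by (subst sum_rotate3[symmetric]) (simp add: sum.cartesian_product)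
  have w_sum: "(\<Sum>b<dB. w (b, e, k)) = l e * p k" if "e < dB" "k < dR * dA" for e k
    unfolding w_def K_def using
      kraus_vec_weight[where l = l and p = p, OF U Y that l[OF that(1)] p[OF that(2)]] .
  have w_zero: "w (b, e, k) = 0" if "b < dB" "e < dB" "k < dR * dA" "l b \<noteq> l e" for b e k
  proof -
    have "K (b, e, k) i = 0" if "i < dR * dA" for i
    proof -
      have "i mod dA < dA" using that by (auto intro!: mod_less_divisor Nat.gr0I)
      then show ?thesis using block \<open>b < dB\<close> \<open>e < dB\<close> \<open>l b \<noteq> l e\<close> by (simp add: K_def kraus_vec_def)
    qed
    then show ?thesis by (simp add: w_def)
  qed
  have w_zero': "w (b, e, k) = 0" if "b < dB" "e < dB" "k < dR * dA" "l e * p k = 0" for b e k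
    using that by (auto simp: w_def K_def kraus_vec_def)
  have "entropy (id_tensor dR dA (diag_channel dA dB U l) \<rho>) \<le> - (\<Sum>n\<in>N. w n * log 2 (t n))"
  proof (rule entropy_sum_outer_le[where x = K and d = "dR * dA"])
    show "id_tensor dR dA (diag_channel dA dB U l) \<rho> \<in> carrier_mat (dR * dA) (dR * dA)" by simp
    show "finite N" by (simp add: N_def)
    show "id_tensor dR dA (diag_channel dA dB U l) \<rho> $$ (i, j) = (\<Sum>n\<in>N. K n i * cnj (K n j))"
      if "i < dR * dA" "j < dR * dA" for i j
      unfolding K_def N_def using id_tensor_diag_channel_index[OF Uc decomp p l that] .
    show "0 \<le> t n" if "n \<in> N" for n
      using that l p multiplicity_of_pos[of _ dB l] by (force simp: N_def t_def)
    show "t n \<noteq> 0" if "n \<in> N" "w n \<noteq> 0" for n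
    proof -
      obtain b e k where n: "n = (b, e, k)" "b < dB" "e < dB" "k < dR * dA" using \<open>n \<in> N\<close>
        by (auto simp: N_def)
      then have "l b = l e" "l e * p k \<noteq> 0" using w_zero w_zero' \<open>w n \<noteq> 0\<close> by blast+
      then show ?thesis using multiplicity_of_pos[OF n(3), of l] by (simp add: n t_def)
    qed
    have "(\<Sum>n\<in>N. t n) = (\<Sum>e<dB. \<Sum>k<dR * dA. p k * (\<Sum>b<dB. if l b =
      l e then l e / multiplicity_of dB l e else 0))"
      unfolding sum_N sum_distrib_left by (intro sum.cong refl) (simp add: t_def)
    also have "\<dots> = (\<Sum>e<dB. \<Sum>k<dR * dA. \<Sum>b<dB. w (b, e, k))"
      by (intro sum.cong refl) (simp add: sum_same_eigenvalue w_sum)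
    finally show "(\<Sum>n\<in>N. t n) \<le> (\<Sum>n\<in>N. w n)" by (simp add: sum_N)
  qed (simp add: w_def)
  \<comment> \<open>The logarithm splits where \<open>t\<close> is positive; at all other triples
    the weight vanishes, so the same formula holds there.\<close>
  also have "(\<Sum>n\<in>N. w n * log 2 (t n)) =
      (\<Sum>e<dB. \<Sum>k<dR * dA. (\<Sum>b<dB. w (b, e, k)) *
        (log 2 (l e / multiplicity_of dB l e) + log 2 (p k)))"
    unfolding sum_N sum_distrib_right
  proof (intro sum.cong refl)
    fix e k b assume "e \<in> {..<dB}" "k \<in> {..<dR * dA}" "b \<in> {..<dB}"
    then have *: "e < dB" "k < dR * dA" "b < dB" by auto
    show "w (b, e, k) * log 2 (t (b, e, k)) =
      w (b, e, k) * (log 2 (l e / multiplicity_of dB l e) + log 2 (p k))"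
    proof (cases "l b = l e \<and> l e * p k \<noteq> 0")
      case True
      then have "0 < l e" "0 < p k" using l[OF *(1)] p[OF *(2)] by auto
      then have "log 2 (l e / multiplicity_of dB l e * p k) =
        log 2 (l e / multiplicity_of dB l e) + log 2 (p k)"
        using multiplicity_of_pos[OF *(1), of l] by (intro log_mult_pos) auto
      then show ?thesis using True by (simp add: t_def)
    next
      case False
      then have "w (b, e, k) = 0" using w_zero w_zero' * by blast
      then show ?thesis by simp
    qed
  qed
  also have "\<dots> = (\<Sum>e<dB. \<Sum>k<dR * dA. p k * (l e * log 2 (l e / multiplicity_of dB l e)) + l e *
    (p k * log 2 (p k)))"
    by (intro sum.cong refl) (simp add: w_sum algebra_simps)
  also have "\<dots> = (\<Sum>e<dB. l e * log 2 (l e / multiplicity_of dB l e)) +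
    (\<Sum>k<dR * dA. p k * log 2 (p k))"
    by (simp add: sum.distrib sum_distrib_right[symmetric] sum_distrib_left[symmetric] p_sum l_sum)
  finally show ?thesis by (simp add: entropy_eq[OF decomp])
qed

text \<open>Following \<open>U\<close> by 1 tensor adj(V) returns the catalyst exactly and leaves
  the channel as it was. The block condition then applies to the new unitary, and linearity
  identifies the map with \<open>diag_channel\<close> on all matrices.\<close>

lemma entropy_production_le:
  assumes l: "\<And>e. e < dB \<Longrightarrow> 0 \<le> l e" and l_sum: "(\<Sum>e<dB. l e) = 1"
    and cat: "catalytic_map dA dB (real_diag dB l) \<Phi>" and \<rho>: "quantum_state (dR * dA) \<rho>"
  shows "entropy (id_tensor dR dA \<Phi> \<rho>) - entropy \<rho> \<le>
    - (\<Sum>e<dB. l e * log 2 (l e / multiplicity_of dB l e))"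
proof -
  obtain U V where U: "unitary_mat (dA * dB) U" and V: "unitary_mat dB V" and \<Phi>: "quantum_map dA \<Phi>"
    and UV: "\<And>\<rho>. quantum_state dA \<rho> \<Longrightarrow>
      ptrace_snd dA dB (U * tensor_mat \<rho> (real_diag dB l) * mat_adjoint U) = \<Phi> \<rho> \<and>
      ptrace_fst dA dB (U * tensor_mat \<rho> (real_diag dB l) * mat_adjoint U) =
        V * real_diag dB l * mat_adjoint V"
    using cat by (auto simp: catalytic_map_def)
  let ?L = "real_diag dB l"
  have Uc: "U \<in> carrier_mat (dA * dB) (dA * dB)" "mat_adjoint U \<in> carrier_mat (dA * dB) (dA * dB)"
    using U by (auto simp: unitary_mat_def)
  have Vc: "V \<in> carrier_mat dB dB" "mat_adjoint V \<in> carrier_mat dB dB" using V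
    by (auto simp: unitary_mat_def)
  let ?T = "tensor_mat (1\<^sub>m dA) (mat_adjoint V)"
  have T: "unitary_mat (dA * dB) ?T"
    by (rule unitary_mat_tensor[OF unitary_mat_one unitary_mat_adjoint[OF V]])
  have Tc: "?T \<in> carrier_mat (dA * dB) (dA * dB)" "mat_adjoint ?T \<in> carrier_mat (dA * dB) (dA * dB)"
    using T by (auto simp: unitary_mat_def)
  define U' where "U' = ?T * U"
  have U': "unitary_mat (dA * dB) U'" unfolding U'_def by (rule unitary_mat_mult[OF T U])
  then have U'c: "U' \<in> carrier_mat (dA * dB) (dA * dB)" by (simp add: unitary_mat_def)
  have eq: "U' * tensor_mat X ?L * mat_adjoint U' =
    ?T * (U * tensor_mat X ?L * mat_adjoint U) * mat_adjoint ?T"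
    if "X \<in> carrier_mat dA dA" for X
    unfolding U'_def adjoint_mult[OF Tc(1) Uc(1)]
    by (rule mat_conj_conj[symmetric, of _ "dA * dB"]) (use Tc Uc that in auto)
  have M: "U * tensor_mat X ?L * mat_adjoint U \<in> carrier_mat (dA * dB) (dA * dB)"
    if "X \<in> carrier_mat dA dA" for X
    using Uc that by (intro mult_carrier_mat[of _ _ "dA * dB"]) auto
  have state_carrier: "\<rho> \<in> carrier_mat dA dA" if "quantum_state dA \<rho>" for \<rho>
    using that by (auto simp: quantum_state_def psd_mat_def hermitian_mat_def)
  have VLV: "mat_adjoint V * (V * ?L * mat_adjoint V) * V = ?L"
    using mat_conj_conj[OF Vc(2,1) _ Vc(2,1), of ?L] V by (simp add: unitary_mat_def)
  have catalyst: "ptrace_fst dA dB (U' * tensor_mat \<rho> ?L * mat_adjoint U') = ?L"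
    if "quantum_state dA \<rho>" for \<rho>
    unfolding eq[OF state_carrier[OF that]]
      ptrace_fst_local_conj[OF Vc(2) M[OF state_carrier[OF that]]]
    using UV[OF that] VLV by simp
  have chan: "diag_channel dA dB U' l \<rho> = \<Phi> \<rho>" if "quantum_state dA \<rho>" for \<rho>
    unfolding diag_channel_def eq[OF state_carrier[OF that]]
      ptrace_snd_local_conj[OF unitary_mat_adjoint[OF V] M[OF state_carrier[OF that]]]
    using UV[OF that] by simp
  have "\<Phi> X = diag_channel dA dB U' l X" if "X \<in> carrier_mat dA dA" for X
    by (rule linear_eq_on_states[of dA])
      (use \<Phi> that chan in \<open>auto simp: quantum_map_def diag_channel_add[OF U'c]
        diag_channel_smult[OF U'c]\<close>)
  then have "id_tensor dR dA \<Phi> \<rho> = id_tensor dR dA (diag_channel dA dB U' l) \<rho>"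
    by (rule id_tensor_cong)
  moreover have "entropy (id_tensor dR dA (diag_channel dA dB U' l) \<rho>) \<le>
    entropy \<rho> - (\<Sum>e<dB. l e * log 2 (l e / multiplicity_of dB l e))"
    using entropy_diag_channel_le[OF U' catalytic_unitary_block_diagonal[OF U' catalyst] l l_sum \<rho>] .
  ultimately show ?thesis by simp
qed

section \<open>Attainment\<close>

lemma spectral_decomp_real_diag: "spectral_decomp d (real_diag d p) (1\<^sub>m d) p"
proof -
  have "mat_adjoint (1\<^sub>m d) = (1\<^sub>m d :: complex mat)" by (intro eq_matI) auto
  then show ?thesis by (simp add: spectral_decomp_iff unitary_mat_one)
qed

lemma id_tensor_one:
  assumes "X \<in> carrier_mat d d" "\<Phi> X \<in> carrier_mat d d"
  shows "id_tensor 1 d \<Phi> X = \<Phi> X"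
proof -
  have "mat d d (\<lambda>(a, a'). X $$ (a, a')) = X" using assms by (intro eq_matI) auto
  then show ?thesis using assms by (intro eq_matI) (auto simp: id_tensor_def)
qed

text \<open>On the index set of each eigenspace, of size \<open>r\<close>, \<open>f\<close> is the \<open>r \<times> r\<close> discrete Fourier matrix.\<close>

lemma exists_blockwise_fourier:
  fixes l :: "nat \<Rightarrow> real"
  obtains f :: "nat \<Rightarrow> nat \<Rightarrow> complex" where
    "\<And>b e. b < d \<Longrightarrow> e < d \<Longrightarrow> l b = l e \<Longrightarrow> f b e = f e b"
    "\<And>b e. b < d \<Longrightarrow> e < d \<Longrightarrow> l b = l e \<Longrightarrow> f b e * cnj (f b e) =
      complex_of_real (1 / multiplicity_of d l e)"
    "\<And>e e'. e < d \<Longrightarrow> e' < d \<Longrightarrow> l e = l e' \<Longrightarrow>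
      (\<Sum>b<d. if l b = l e then f b e * cnj (f b e') else 0) = (if e = e' then 1 else 0)"
proof -
  define S where "S x = {m. m < d \<and> l m = x}" for x
  have "\<exists>h. bij_betw h (S x) {0..<card (S x)}" for x
    by (rule ex_bij_betw_finite_nat) (simp add: S_def)
  then obtain h where h: "\<And>x. bij_betw (h x) (S x) {0..<card (S x)}" by metis
  define r where "r e = card (S (l e))" for e
  \<comment> \<open>\<open>pos b\<close> is the position of \<open>b\<close> among the indices with
    the same eigenvalue, so within a block f b e is omega^(pos b pos e) / sqrt r with omega a
    primitive r-th root of unity.\<close>
  define pos where "pos b = h (l b) b" for b
  define z where "z e = cis (2 * pi * real (pos e) / real (r e))" for e
  define f where "f b e = z e ^ pos b / complex_of_real (sqrt (real (r e)))" for b e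
  have r_mult: "multiplicity_of d l e = real (r e)" for e
    by (simp add: multiplicity_of_def r_def S_def)
  have r_pos: "0 < r e" if "e < d" for e using multiplicity_of_pos[OF that, of l]
    by (simp add: r_mult)
  have pos_bij: "bij_betw pos (S (l e)) {..<r e}" for e
  proof -
    have "bij_betw (h (l e)) (S (l e)) {..<r e}" using h[of "l e"]
      by (simp add: r_def lessThan_atLeast0)
    then show ?thesis by (rule bij_betw_cong[THEN iffD1, rotated]) (auto simp: pos_def S_def)
  qed
  have pos_less: "pos e < r e" if "e < d" for e
    using pos_bij[of e] that by (auto simp: bij_betw_def S_def)
  have z_norm: "z e * cnj (z e) = 1" for e by (simp add: z_def complex_mult_cnj)
  have z_root: "z e ^ r e = 1" if "e < d" for e
    using r_pos[OF that] by (simp add: z_def DeMoivre)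
  have r_cong: "r b = r e" if "l b = l e" for b e using that by (simp add: r_def)
  have sqrt_r: "complex_of_real (sqrt (real (r e))) * complex_of_real (sqrt (real (r e))) =
    of_nat (r e)" for e
    by (simp flip: of_real_mult)
  have prod: "f b e * cnj (f b e') = (z e * cnj (z e')) ^ pos b / of_nat (r e)" if "l e = l e'"
    for b e e'
    using r_cong[OF that] by (simp add: f_def power_mult_distrib sqrt_r)
  show ?thesis
  proof (rule that[of f])
    fix b e assume be: "b < d" "e < d" "l b = l e"
    \<comment> \<open>Both sides are omega to the power pos b times pos e. The symmetry later turns
      orthogonality of columns into orthogonality of rows.\<close>
    then have "z e ^ pos b = z b ^ pos e" by (simp add: z_def DeMoivre r_cong[OF be(3)] mult_ac)
    then show "f b e = f e b" using r_cong[OF be(3)] by (simp add: f_def)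
    show "f b e * cnj (f b e) = complex_of_real (1 / multiplicity_of d l e)"
      by (simp add: prod z_norm r_mult)
  next
    fix e e' assume e: "e < d" "e' < d" "l e = l e'"
    let ?q = "z e * cnj (z e')"
    have "{..<d} \<inter> {b. l b = l e} = S (l e)" by (auto simp: S_def)
    then have "(\<Sum>b<d. if l b = l e then f b e * cnj (f b e') else 0) =
      (\<Sum>b\<in>S (l e). ?q ^ pos b / of_nat (r e))"
      by (simp add: sum.If_cases prod[OF e(3)])
    also have "\<dots> = (\<Sum>k<r e. ?q ^ k / of_nat (r e))"
      by (rule sum.reindex_bij_betw[OF pos_bij])
    also have "\<dots> = (\<Sum>k<r e. ?q ^ k) / of_nat (r e)" by (simp add: sum_divide_distrib)
    also have "\<dots> = (if e = e' then 1 else 0)"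
    proof (cases "e = e'")
      case True
      then show ?thesis using r_pos[OF e(1)] by (simp add: z_norm)
    next
      case False
      have "pos e \<noteq> pos e'"
        using pos_bij[of e] False e by (auto simp: bij_betw_def inj_on_def S_def)
      then have "z e \<noteq> z e'"
        using bij_betw_roots_unity[OF r_pos[OF e(1)]] pos_less[OF e(1)] pos_less[OF e(2)]
          r_cong[OF e(3)]
        by (auto simp: bij_betw_def inj_on_def z_def)
      moreover have "z e = ?q * z e'" using z_norm[of e'] by (simp add: mult_ac)
      ultimately have "?q \<noteq> 1" by (metis mult_1)
      moreover have "?q ^ r e = 1"
        using z_root[OF e(1)] z_root[OF e(2)] r_cong[OF e(3)]
          by (simp add: power_mult_distrib flip: complex_cnj_power)
      \<comment> \<open>A full geometric sum over the powers of an r-th root of unity different from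
        1.\<close>
      ultimately have "(\<Sum>k<r e. ?q ^ k) = 0" by (simp add: geometric_sum)
      then show ?thesis using False by simp
    qed
    finally show "(\<Sum>b<d. if l b = l e then f b e * cnj (f b e') else 0) = (if e = e' then 1 else 0)" .
  qed
qed

text \<open>The system \<open>A\<close> is a cyclic register of size \<open>d\<^sup>2\<close>. The block \<open>\<langle>b|U|e\<rangle>\<close> is \<open>f b e\<close> times the shift by
  \<open>b d + e\<close>; since the shifts are pairwise distinct on the register state \<open>0\<close>, all the Kraus
  operators \<open>\<surd>l\<^sub>e \<langle>b|U|e\<rangle>\<close> map that state to orthogonal ones.\<close>

definition shift_unitary :: "nat \<Rightarrow> (nat \<Rightarrow> real) \<Rightarrow> (nat \<Rightarrow> nat \<Rightarrow> complex) \<Rightarrow> complex mat" where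
  "shift_unitary d l f = mat (d * d * d) (d * d * d) (\<lambda>(i, j).
     if l (i mod d) = l (j mod d) \<and> i div d = (j div d + (i mod d * d + j mod d)) mod (d * d)
     then f (i mod d) (j mod d) else 0)"

lemma shift_unitary_index:
  assumes "a < d * d" "b < d" "c < d * d" "e < d"
  shows "shift_unitary d l f $$ (a * d + b, c * d + e) =
    (if l b = l e \<and> a = (c + (b * d + e)) mod (d * d) then f b e else 0)"
  using assms by (simp add: shift_unitary_def pair_index_less)

text \<open>This is the entry (c', c) of adj(U_b'e') U_be. Each block is a scalar times a cyclic
  shift, so a single \<open>a\<close> survives, and both shifts reach it exactly under the
  congruence.\<close>

lemma shift_unitary_sum:
  assumes "b < d" "c < d * d" "e < d" "b' < d" "c' < d * d" "e' < d"
  shows "(\<Sum>a<d * d. shift_unitary d l f $$ (a * d + b, c * d + e) * cnj (shift_unitary d l f $$ (a *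
    d + b', c' * d + e'))) =
    (if l b = l e \<and> l b' =
      l e' \<and> [c + (b * d + e) = c' + (b' * d + e')] (mod d * d) then f b e * cnj (f b' e') else 0)"
proof -
  have "(\<Sum>a<d * d. shift_unitary d l f $$ (a * d + b, c * d + e) * cnj (shift_unitary d l f $$ (a *
    d + b', c' * d + e'))) =
    (\<Sum>a<d * d. if a = (c + (b * d + e)) mod (d * d) then
      (if l b = l e \<and> l b' =
        l e' \<and> [c + (b * d + e) = c' + (b' * d + e')] (mod d * d) then f b e * cnj (f b' e') else 0)
          else 0)"
    using assms by (intro sum.cong refl) (auto simp: shift_unitary_index cong_def)
  then show ?thesis using assms by simp
qed

text \<open>The part \<open>b * d\<close> of the shift is common to both factors and cancels, so the
  congruence does not involve \<open>b\<close> and the sum over \<open>b\<close> is column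
  orthogonality of \<open>f\<close>. What survives has e = e', and then c = c' since both lie below
  d * d.\<close>

lemma unitary_shift_unitary:
  assumes orth: "\<And>e e'. e < d \<Longrightarrow> e' < d \<Longrightarrow> l e = l e' \<Longrightarrow>
      (\<Sum>b<d. if l b = l e then f b e * cnj (f b e') else 0) = (if e = e' then 1 else 0)"
  shows "unitary_mat (d * d * d) (shift_unitary d l f)"
proof (rule unitary_matI)
  let ?U = "shift_unitary d l f"
  show U: "?U \<in> carrier_mat (d * d * d) (d * d * d)" by (simp add: shift_unitary_def)
  show "mat_adjoint ?U * ?U = 1\<^sub>m (d * d * d)"
  proof (rule eq_mat_pairI[of _ "d * d" d "d * d" d])
    fix c' e' c e assume ind: "c' < d * d" "e' < d" "c < d * d" "e < d"
    have cong_iff: "[c + (b * d + e) = c' + (b * d + e')] (mod d * d) \<longleftrightarrow>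
      [c + e = c' + e'] (mod d * d)" for b
      using cong_add_lcancel_nat[of "b * d" "c + e" "c' + e'" "d * d"] by (simp add: add_ac)
    have "(mat_adjoint ?U * ?U) $$ (c' * d + e', c * d + e) =
      (\<Sum>a<d * d. \<Sum>b<d. ?U $$ (a * d + b, c * d + e) * cnj (?U $$ (a * d + b, c' * d + e')))"
      using U ind by (subst mult_index[of _ "d * d * d" "d * d * d" _ "d * d * d"])
        (auto simp: pair_index_less sum_lessThan_mult mult.commute[of "cnj _"])
    also have "\<dots> = (\<Sum>b<d. \<Sum>a<d * d. ?U $$ (a * d + b, c * d + e) * cnj (?U $$ (a * d + b, c' * d +
      e')))"
      by (rule sum.swap)
    also have "\<dots> = (\<Sum>b<d. if l b = l e \<and> l b =
      l e' \<and> [c + e = c' + e'] (mod d * d) then f b e * cnj (f b e') else 0)"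
      using ind by (intro sum.cong refl) (simp add: shift_unitary_sum cong_iff)
    also have "\<dots> = (if l e = l e' \<and> [c + e = c' + e'] (mod d * d) then
        (\<Sum>b<d. if l b = l e then f b e * cnj (f b e') else 0) else 0)"
      by (auto intro!: sum.cong sum.neutral)
    also have "\<dots> = (if c = c' \<and> e = e' then 1 else 0)"
      using ind orth by (auto simp: cong_add_rcancel_nat cong_less_modulus_unique_nat)
    also have "\<dots> = 1\<^sub>m (d * d * d) $$ (c' * d + e', c * d + e)"
    proof -
      have "c' * d + e' = c * d + e \<longleftrightarrow> c = c' \<and> e = e'"
        using ind(2,4) by (metis div_mult_self3 div_less add_0 add.commute mod_mult_self3 mod_less
          less_nat_zero_code)
      then show ?thesis using ind by (simp add: pair_index_less)
    qed
    finally show "(mat_adjoint ?U * ?U) $$ (c' * d + e', c * d + e) =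
      1\<^sub>m (d * d * d) $$ (c' * d + e', c * d + e)" .
  qed (use U in \<open>auto intro!: mult_carrier_mat[of _ _ "d * d * d"]\<close>)
qed

text \<open>Now the part \<open>e\<close> of the shift cancels, so the sum over \<open>e\<close>
  separates from the register and is row orthogonality of \<open>f\<close> within an eigenspace,
  where \<open>l e\<close> is constant.\<close>

lemma ptrace_fst_shift_unitary:
  assumes orth: "\<And>b b'. b < d \<Longrightarrow> b' < d \<Longrightarrow> l b = l b' \<Longrightarrow>
      (\<Sum>e<d. if l b = l e then f b e * cnj (f b' e) else 0) = (if b = b' then 1 else 0)"
    and \<rho>: "quantum_state (d * d) \<rho>"
  shows "ptrace_fst (d * d) d (shift_unitary d l f * tensor_mat \<rho> (real_diag d l) * mat_adjoint
    (shift_unitary d l f)) = real_diag d l"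
proof (rule eq_matI)
  let ?U = "shift_unitary d l f"
  have U: "?U \<in> carrier_mat (d * d * d) (d * d * d)" by (simp add: shift_unitary_def)
  have \<rho>c: "\<rho> \<in> carrier_mat (d * d) (d * d)" using \<rho>
    by (auto simp: quantum_state_def psd_mat_def hermitian_mat_def)
  fix b b' assume "b < dim_row (real_diag d l)" "b' < dim_col (real_diag d l)"
  then have b: "b < d" "b' < d" by auto
  \<comment> \<open>The trace of \<open>\<rho>\<close> times a shift by a multiple of
    \<open>d\<close>. For b = b' the shift is trivial and the trace is 1; for b different from b'
    the coefficient of \<open>G\<close> vanishes.\<close>
  define G where "G = (\<Sum>c<d * d. \<Sum>c'<d * d. if [c + b * d = c' + b' * d] (mod d * d)
    then \<rho> $$ (c, c') else 0)"
  have cong_iff: "[c + (b * d + e) = c' + (b' * d + e)] (mod d * d) \<longleftrightarrow>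
    [c + b * d = c' + b' * d] (mod d * d)" for c c' e
    using cong_add_rcancel_nat[of "c + b * d" e "c' + b' * d" "d * d"] by (simp add: add_ac)
  have "ptrace_fst (d * d) d (?U * tensor_mat \<rho> (real_diag d l) * mat_adjoint ?U) $$ (b, b') =
    (\<Sum>a<d * d. \<Sum>e<d. \<Sum>c<d * d. \<Sum>c'<d * d. complex_of_real (l e) * \<rho> $$ (c, c') *
       (?U $$ (a * d + b, c * d + e) * cnj (?U $$ (a * d + b', c' * d + e))))"
    using b by (simp add: ptrace_fst_def conj_tensor_diag_index[OF U \<rho>c] sum_distrib_left mult_ac
      del: index_mult_mat(1))
  also have "\<dots> = (\<Sum>e<d. \<Sum>c<d * d. \<Sum>c'<d * d. complex_of_real (l e) * \<rho> $$ (c, c') *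
       (\<Sum>a<d * d. ?U $$ (a * d + b, c * d + e) * cnj (?U $$ (a * d + b', c' * d + e))))"
    unfolding sum_distrib_left by (rule sum_rotate4)
  also have "\<dots> = (\<Sum>e<d. \<Sum>c<d * d. \<Sum>c'<d * d. (if l b = l e \<and> l b' =
    l e then complex_of_real (l e) * (f b e * cnj (f b' e)) else 0) *
      (if [c + b * d = c' + b' * d] (mod d * d) then \<rho> $$ (c, c') else 0))"
    using b by (intro sum.cong refl) (simp add: shift_unitary_sum cong_iff)
  also have "\<dots> = (\<Sum>e<d. if l b = l e \<and> l b' =
    l e then complex_of_real (l e) * (f b e * cnj (f b' e)) else 0) * G"
    unfolding G_def sum_distrib_left[symmetric] sum_distrib_right ..
  also have "(\<Sum>e<d. if l b = l e \<and> l b' =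
    l e then complex_of_real (l e) * (f b e * cnj (f b' e)) else 0) =
      (if l b = l b' then complex_of_real (l b) * (\<Sum>e<d. if l b =
        l e then f b e * cnj (f b' e) else 0) else 0)"
    by (auto simp: sum_distrib_left intro!: sum.cong sum.neutral)
  also have "\<dots> = (if b = b' then complex_of_real (l b) else 0)" using b orth by auto
  also have "\<dots> * G = real_diag d l $$ (b, b')"
  proof (cases "b = b'")
    case True
    have "G = (\<Sum>c<d * d. \<Sum>c'<d * d. if c = c' then \<rho> $$ (c, c') else 0)"
      unfolding G_def True by (intro sum.cong refl) (auto simp: cong_add_rcancel_nat
        cong_less_modulus_unique_nat)
    also have "\<dots> = mat_trace \<rho>" using \<rho>c by (simp add: mat_trace_def)
    finally show ?thesis using \<rho> True b by (simp add: quantum_state_def)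
  qed (use b in simp)
  finally show "ptrace_fst (d * d) d (?U * tensor_mat \<rho> (real_diag d l) * mat_adjoint ?U) $$ (b, b')
    = real_diag d l $$ (b, b')" .
qed (auto simp: ptrace_fst_def)

text \<open>The register starts in its basis state 0, with a one-dimensional reference. The Kraus
  operator of (b, e) sends it to a multiple of the basis state b * d + e. The output is therefore
  diagonal with the weights of the comparison distribution, so the cross-entropy bound becomes an
  equality.\<close>

lemma entropy_production_attained:
  assumes l: "\<And>e. e < d \<Longrightarrow> 0 \<le> l e" and l_sum: "(\<Sum>e<d. l e) = 1"
  obtains \<Phi> \<rho> where "catalytic_map (d * d) d (real_diag d l) \<Phi>" "quantum_state (1 * (d * d)) \<rho>"
    "entropy (id_tensor 1 (d * d) \<Phi> \<rho>) - entropy \<rho> =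
      - (\<Sum>e<d. l e * log 2 (l e / multiplicity_of d l e))"
proof -
  let ?N = "d * d"
  have d: "0 < d" using l_sum by (auto intro: Nat.gr0I)
  obtain f where f_sym: "\<And>b e. b < d \<Longrightarrow> e < d \<Longrightarrow> l b = l e \<Longrightarrow> f b e = f e b"
    and f_norm: "\<And>b e. b < d \<Longrightarrow> e < d \<Longrightarrow> l b = l e \<Longrightarrow> f b e * cnj (f b e) =
      complex_of_real (1 / multiplicity_of d l e)"
    and cols: "\<And>e e'. e < d \<Longrightarrow> e' < d \<Longrightarrow> l e = l e' \<Longrightarrow>
      (\<Sum>b<d. if l b = l e then f b e * cnj (f b e') else 0) = (if e = e' then 1 else 0)"
    using exists_blockwise_fourier[of d l] by blast
  have rows: "(\<Sum>e<d. if l b = l e then f b e * cnj (f b' e) else 0) = (if b = b' then 1 else 0)"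
    if "b < d" "b' < d" "l b = l b'" for b b'
  proof -
    have "(\<Sum>e<d. if l b = l e then f b e * cnj (f b' e) else 0) = (\<Sum>e<d. if l e =
      l b then f e b * cnj (f e b') else 0)"
      using that by (intro sum.cong refl) (auto simp: f_sym[of b] f_sym[of b'])
    then show ?thesis using cols[OF that] by simp
  qed
  define U where "U = shift_unitary d l f"
  have U: "unitary_mat (?N * d) U" unfolding U_def by (rule unitary_shift_unitary[OF cols])
  then have Uc: "U \<in> carrier_mat (?N * d) (?N * d)" by (simp add: unitary_mat_def)
  let ?\<Phi> = "diag_channel ?N d U l" and ?p0 = "\<lambda>i :: nat. if i = 0 then 1 else 0 :: real"
  let ?\<rho> = "real_diag ?N ?p0"
  have one: "mat_adjoint (1\<^sub>m d) = (1\<^sub>m d :: complex mat)" by (intro eq_matI) auto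
  have cat: "catalytic_map ?N d (real_diag d l) ?\<Phi>"
    unfolding catalytic_map_def
  proof (intro conjI)
    show "quantum_map ?N ?\<Phi>" by (rule quantum_map_diag_channel[OF U l l_sum])
    have "ptrace_snd ?N d (U * tensor_mat \<rho> (real_diag d l) * mat_adjoint U) = ?\<Phi> \<rho> \<and>
      ptrace_fst ?N d (U * tensor_mat \<rho> (real_diag d l) * mat_adjoint U) =
        1\<^sub>m d * real_diag d l * mat_adjoint (1\<^sub>m d)"
      if "quantum_state ?N \<rho>" for \<rho>
    proof -
      have "1\<^sub>m d * real_diag d l * mat_adjoint (1\<^sub>m d) = real_diag d l" by (simp add: one)
      moreover have "ptrace_fst ?N d (U * tensor_mat \<rho> (real_diag d l) * mat_adjoint U) =
        real_diag d l"
        unfolding U_def by (rule ptrace_fst_shift_unitary[OF rows that])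
      ultimately show ?thesis by (simp only: diag_channel_def)
    qed
    then show "\<exists>U V. unitary_mat (?N * d) U \<and> unitary_mat d V \<and> (\<forall>\<rho>. quantum_state ?N \<rho> \<longrightarrow>
       ptrace_snd ?N d (U * tensor_mat \<rho> (real_diag d l) * mat_adjoint U) = ?\<Phi> \<rho> \<and>
       ptrace_fst ?N d (U * tensor_mat \<rho> (real_diag d l) * mat_adjoint U) =
         V * real_diag d l * mat_adjoint V)"
      using U unitary_mat_one[of d] by -
        (rule exI[of _ U], rule exI[of _ "1\<^sub>m d"], intro conjI allI impI, auto)
  qed
  have \<rho>: "quantum_state (1 * ?N) ?\<rho>"
  proof -
    have "psd_mat ?N ?\<rho>"
      by (rule psd_mat_sum_outer[where N = "{()}" and x = "\<lambda>_ i. complex_of_real (?p0 i)"]) auto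
    moreover have "mat_trace ?\<rho> = 1"
    proof -
      have "mat_trace ?\<rho> = complex_of_real (\<Sum>i<?N. ?p0 i)"
        unfolding mat_trace_def of_real_sum by (intro sum.cong) auto
      also have "(\<Sum>i<?N. ?p0 i) = 1" using d by simp
      finally show ?thesis by simp
    qed
    ultimately show ?thesis by (simp add: quantum_state_def)
  qed
  \<comment> \<open>The register index \<open>i\<close> encodes the pair b = i div d, e = i mod
    d.\<close>
  define q where "q i = (if l (i div d) =
    l (i mod d) then l (i mod d) / multiplicity_of d l (i mod d) else 0)" for i
  have out: "?\<Phi> ?\<rho> = real_diag ?N q"
  proof (rule eq_matI)
    fix a a' assume "a < dim_row (real_diag ?N q)" "a' < dim_col (real_diag ?N q)"
    then have a: "a < ?N" "a' < ?N" by auto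
    have "?\<Phi> ?\<rho> $$ (a, a') = (\<Sum>b<d. \<Sum>e<d. complex_of_real (l e) * (\<Sum>c<?N. \<Sum>c'<?N.
       U $$ (a * d + b, c * d + e) * ?\<rho> $$ (c, c') * cnj (U $$ (a' * d + b, c' * d + e))))"
      using a by (intro diag_channel_index[OF Uc]) auto
    also have "\<dots> = (\<Sum>b<d. \<Sum>e<d. complex_of_real (l e) * (\<Sum>c<?N. \<Sum>c'<?N. if c = 0 then if c' = 0 then
       U $$ (a * d + b, 0 * d + e) * cnj (U $$ (a' * d + b, 0 * d + e)) else 0 else 0))"
      by (intro sum.cong refl arg_cong2[of _ _ _ _ "(*)"]) auto
    also have "\<dots> = (\<Sum>b<d. \<Sum>e<d. complex_of_real (l e) * (\<Sum>c<?N. if c = 0 then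
       U $$ (a * d + b, 0 * d + e) * cnj (U $$ (a' * d + b, 0 * d + e)) else 0))"
      using d by (intro sum.cong refl arg_cong2[of _ _ _ _ "(*)"]) auto
    also have "\<dots> = (\<Sum>b<d. \<Sum>e<d. complex_of_real (l e) *
      (U $$ (a * d + b, 0 * d + e) * cnj (U $$ (a' * d + b, 0 * d + e))))"
      using d by simp
    \<comment> \<open>Both entries are nonzero only if a and a' equal b * d + e and the eigenvalues
      agree; there the squared modulus 1 / r of \<open>f b e\<close> turns \<open>l e\<close> into
      \<open>q a\<close>.\<close>
    also have "\<dots> = (\<Sum>b<d. \<Sum>e<d. if b * d + e = a then if a =
      a' then complex_of_real (q a) else 0 else 0)"
    proof (intro sum.cong refl)
      fix b e assume "b \<in> {..<d}" "e \<in> {..<d}"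
      then have be: "b < d" "e < d" by auto
      have idx: "U $$ (x * d + b, 0 * d + e) = (if l b = l e \<and> x = b * d + e then f b e else 0)"
        if "x < ?N" for x
        using that be d pair_index_less[OF be] unfolding U_def by (subst shift_unitary_index) auto
      have q: "q (b * d + e) = (if l b = l e then l e / multiplicity_of d l e else 0)" using be
        by (simp add: q_def)
      show "complex_of_real (l e) *
        (U $$ (a * d + b, 0 * d + e) * cnj (U $$ (a' * d + b, 0 * d + e))) =
        (if b * d + e = a then if a = a' then complex_of_real (q a) else 0 else 0)"
        unfolding idx[OF a(1)] idx[OF a(2)] using q f_norm[OF be] by auto
    qed
    also have "\<dots> = (\<Sum>i<?N. if i = a then if a = a' then complex_of_real (q a) else 0 else 0)"
      by (simp only: sum_lessThan_mult)
    also have "\<dots> = real_diag ?N q $$ (a, a')" using a by simp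
    finally show "?\<Phi> ?\<rho> $$ (a, a') = real_diag ?N q $$ (a, a')" .
  qed auto
  have "entropy (id_tensor 1 ?N ?\<Phi> ?\<rho>) = - (\<Sum>i<?N. q i * log 2 (q i))"
    by (subst id_tensor_one) (auto simp: out entropy_eq[OF spectral_decomp_real_diag])
  also have "(\<Sum>i<?N. q i * log 2 (q i)) = (\<Sum>e<d. \<Sum>b<d. if l b = l e then
      l e * log 2 (l e / multiplicity_of d l e) / multiplicity_of d l e else 0)"
    unfolding sum_lessThan_mult by (subst sum.swap) (auto simp: q_def intro!: sum.cong)
  \<comment> \<open>For each \<open>e\<close> the admissible values of \<open>b\<close> carry equal
    terms, and their number cancels the divisor.\<close>
  also have "\<dots> = (\<Sum>e<d. l e * log 2 (l e / multiplicity_of d l e))"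
    by (intro sum.cong refl) (simp add: sum_same_eigenvalue)
  finally have "entropy (id_tensor 1 ?N ?\<Phi> ?\<rho>) =
    - (\<Sum>e<d. l e * log 2 (l e / multiplicity_of d l e))" .
  moreover have "entropy ?\<rho> = 0"
    by (auto simp: entropy_eq[OF spectral_decomp_real_diag] intro!: sum.neutral)
  ultimately show ?thesis using that[OF cat \<rho>] by simp
qed

theorem theorem7:
  fixes dB :: nat and \<sigma> :: "complex mat"
  assumes "quantum_state dB \<sigma>"
  shows "is_maximal_entropy_production dB \<sigma> (entropy \<sigma> + Delta \<sigma>)"
proof -
  have psd: "psd_mat dB \<sigma>" using assms by (simp add: quantum_state_def)
  then obtain W l where decomp: "spectral_decomp dB \<sigma> W l"
    using hermitian_spectral_decomp unfolding psd_mat_def by blast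
  note W = decomp_unitary[OF decomp] and \<sigma> = decomp_carrier[OF decomp]
  have Wc: "W \<in> carrier_mat dB dB" "mat_adjoint W \<in> carrier_mat dB dB" using W
    by (auto simp: unitary_mat_def)
  let ?L = "real_diag dB l"
  have \<sigma>_eq: "\<sigma> = W * ?L * mat_adjoint W" using decomp by (simp add: spectral_decomp_iff)
  \<comment> \<open>The inverse rotation, which carries the extremal map found for the diagonal
    catalyst back to \<open>\<sigma>\<close>.\<close>
  have L_eq: "?L = mat_adjoint W * \<sigma> * mat_adjoint (mat_adjoint W)"
    unfolding \<sigma>_eq using mat_conj_conj[OF Wc(2,1) _ Wc(2,1), of ?L] W by (simp add: unitary_mat_def)
  have l: "0 \<le> l e" if "e < dB" for e using psd_decomp_nonneg[OF decomp psd that] .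
  have "complex_of_real (\<Sum>e<dB. l e) = 1"
    using assms mat_trace_decomp[OF decomp] by (simp add: quantum_state_def)
  then have l_sum: "(\<Sum>e<dB. l e) = 1" by (metis of_real_eq_1_iff)
  have value_eq: "entropy \<sigma> + Delta \<sigma> = - (\<Sum>e<dB. l e * log 2 (l e / multiplicity_of dB l e))"
    by (rule entropy_plus_Delta_eq[OF decomp l])
  show ?thesis
    unfolding is_maximal_entropy_production_def
  proof
    obtain \<Phi> \<rho> where cat: "catalytic_map (dB * dB) dB ?L \<Phi>" and \<rho>: "quantum_state (1 * (dB * dB)) \<rho>"
      and attained: "entropy (id_tensor 1 (dB * dB) \<Phi> \<rho>) - entropy \<rho> =
        - (\<Sum>e<dB. l e * log 2 (l e / multiplicity_of dB l e))"
      by (rule entropy_production_attained[OF l l_sum])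
    have "catalytic_map (dB * dB) dB \<sigma> \<Phi>"
      using catalytic_map_conj[OF unitary_mat_adjoint[OF W] \<sigma>] cat unfolding L_eq[symmetric] .
    moreover have "entropy \<sigma> + Delta \<sigma> = entropy (id_tensor 1 (dB * dB) \<Phi> \<rho>) - entropy \<rho>"
      using value_eq attained by simp
    ultimately show "entropy \<sigma> + Delta \<sigma> \<in> entropy_productions dB \<sigma>"
      unfolding entropy_productions_def using \<rho> by blast
    show "\<forall>x\<in>entropy_productions dB \<sigma>. x \<le> entropy \<sigma> + Delta \<sigma>"
    proof
      fix x assume "x \<in> entropy_productions dB \<sigma>"
      then obtain dR dA \<Phi> \<rho> where x: "x = entropy (id_tensor dR dA \<Phi> \<rho>) - entropy \<rho>"
        and cat: "catalytic_map dA dB \<sigma> \<Phi>" and \<rho>: "quantum_state (dR * dA) \<rho>"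
        by (auto simp: entropy_productions_def)
      \<comment> \<open>The opposite direction: an arbitrary map using \<open>\<sigma>\<close> is
        also catalytic for the diagonal form, to which the bound applies.\<close>
      have L: "catalytic_map dA dB ?L \<Phi>"
        by (rule catalytic_map_conj[OF W]) (use cat \<sigma>_eq in auto)
      show "x \<le> entropy \<sigma> + Delta \<sigma>"
        unfolding x value_eq by (rule entropy_production_le[OF l l_sum L \<rho>])
    qed
  qed
qed

end
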